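(* Let $n_L$ be fixed and consider a sequence of hub models with a null component with $n\to\infty$, $T\to\infty$, satisfying the standing assumption on $\rho$ in the context. Let $d,v\in(0,1]$ (possibly depending on the index of the sequence) be such that: (i) for each $i=1,\dots,n_L$ there exists a set $V_i\subset\{1,\dots,n\}$ with $|V_i|\ge vn/n_L$ and $A_{ij}-A_{i'j}\ge d$ for all $j\in V_i$ and all $i'\in\{0,1,\dots,n_L\}$, $i'\ne i$; (ii) $A_{ii'}$ is bounded away from $1$ (by a constant) for all $i\in\{0,\dots,n_L\}$, $i'\in\{1,\dots,n_L\}$, $i\ne i'$. If $(\log T)/(d^2vT)=o(1)$ and $d^4v^2n\to\infty$, then $$\frac{T_e}{T}=o_p(1).$$
   Context: Hub model with a null component: nodes $1,\dots,n$; leaders (possible hubs) $1,\dots,n_L$ with $n_L\le n$; label $0$ denotes a hubless group. Parameters: $\rho=(\rho_0,\dots,\rho_{n_L})$ with $\rho_i\ge0$, $\sum_{i=0}^{n_L}\rho_i=1$, and $A=(A_{ij})_{0\le i\le n_L,1\le j\le n}$ with entries in $[0,1]$ and $A_{ii}=1$ for $1\le i\le n_L$ (row $0$ is also denoted $\pi_j=A_{0j}$). Independently for $t=1,\dots,T$, a latent label $z_*^{(t)}\in\{0,\dots,n_L\}$ is drawn with $\mathbb P(z_*^{(t)}=i)=\rho_i$, and given $z_*^{(t)}=i$ the variables $G_j^{(t)}\in\{0,1\}$, $j=1,\dots,n$, are independent with $\mathbb P(G_j^{(t)}=1\mid z_*^{(t)}=i)=A_{ij}$. Only $G$ is observed.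 Profile likelihood estimator: for an assignment $z=(z^{(1)},\dots,z^{(T)})\in\{0,\dots,n_L\}^T$ let $t_i=\sum_t1(z^{(t)}=i)$, $\hat A^z_{ij}=\frac1{t_i}\sum_tG_j^{(t)}1(z^{(t)}=i)$, and $$L_G(z)=\sum_{t=1}^T\sum_{j=1}^n G_j^{(t)}\log\hat A^z_{z^{(t)},j}+(1-G_j^{(t)})\log(1-\hat A^z_{z^{(t)},j}),\qquad 0\log0=0.$$ An assignment is feasible if, for every $t$, either $z^{(t)}=0$ or $G^{(t)}_{z^{(t)}}=1$. $\hat z$ is a maximizer of $L_G(z)$ over feasible assignments. $T_e=\sum_t1(z_*^{(t)}\neq\hat z^{(t)})$ is the number of mislabeled groups. Asymptotics: $n,T,\rho,A,d,v$ vary along a sequence while $n_L$ is fixed; $o(1)$ and $o_p(1)$ are along this sequence, and "constant" means independent of the sequence index. Standing assumption: $\min_{0\le i\le n_L}\rho_i=c_{\min*}/n_L$ and $\max_{0\le i\le n_L}\rho_i=c_{\max*}/n_L$ with positive constants $c_{\min*},c_{\max*}$. *)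

theory Defs
  imports "HOL-Probability.Probability"
begin

text \<open>
  Throughout, \<open>nL\<close> is the number of leaders, \<open>n\<close> the number of nodes and \<open>T\<close> the number of groups.
  Nodes and groups are indexed from 1; labels range over \<open>{0..nL}\<close>, where 0 is the hubless label.
\<close>

definition hub_params :: "nat \<Rightarrow> nat \<Rightarrow> (nat \<Rightarrow> real) \<Rightarrow> (nat \<Rightarrow> nat \<Rightarrow> real) \<Rightarrow> bool" where
  "hub_params nL n \<rho> A \<longleftrightarrow>
     nL \<le> n \<and>
     (\<forall>i\<in>{0..nL}. 0 \<le> \<rho> i) \<and> (\<Sum>i\<in>{0..nL}. \<rho> i) = 1 \<and>
     (\<forall>i\<in>{0..nL}. \<forall>j\<in>{1..n}. 0 \<le> A i j \<and> A i j \<le> 1) \<and>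
     (\<forall>i\<in>{1..nL}. A i i = 1)"

text \<open>The label distribution is meaningful only if \<^term>\<open>\<rho>\<close> is a probability vector on \<open>{0..nL}\<close>.\<close>

definition label_pmf :: "nat \<Rightarrow> (nat \<Rightarrow> real) \<Rightarrow> nat pmf" where
  "label_pmf nL \<rho> = embed_pmf (\<lambda>i. if i \<le> nL then \<rho> i else 0)"

definition group_pmf ::
  "nat \<Rightarrow> nat \<Rightarrow> (nat \<Rightarrow> real) \<Rightarrow> (nat \<Rightarrow> nat \<Rightarrow> real) \<Rightarrow> (nat \<times> (nat \<Rightarrow> bool)) pmf" where
  "group_pmf nL n \<rho> A =
     bind_pmf (label_pmf nL \<rho>) (\<lambda>i.
       map_pmf (Pair i) (Pi_pmf {1..n} False (\<lambda>j. bernoulli_pmf (A i j))))"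

definition hub_pmf ::
  "nat \<Rightarrow> nat \<Rightarrow> nat \<Rightarrow> (nat \<Rightarrow> real) \<Rightarrow> (nat \<Rightarrow> nat \<Rightarrow> real) \<Rightarrow> (nat \<Rightarrow> nat \<times> (nat \<Rightarrow> bool)) pmf" where
  "hub_pmf nL n T \<rho> A = Pi_pmf {1..T} (0, \<lambda>_. False) (\<lambda>_. group_pmf nL n \<rho> A)"

definition latent :: "(nat \<Rightarrow> nat \<times> (nat \<Rightarrow> bool)) \<Rightarrow> nat \<Rightarrow> nat" where
  "latent \<omega> t = fst (\<omega> t)"

definition observed :: "(nat \<Rightarrow> nat \<times> (nat \<Rightarrow> bool)) \<Rightarrow> nat \<Rightarrow> nat \<Rightarrow> bool" where
  "observed \<omega> t = snd (\<omega> t)"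

definition group_count :: "nat \<Rightarrow> (nat \<Rightarrow> nat) \<Rightarrow> nat \<Rightarrow> nat" where
  "group_count T z i = card {t\<in>{1..T}. z t = i}"

definition A_hat :: "nat \<Rightarrow> (nat \<Rightarrow> nat \<Rightarrow> bool) \<Rightarrow> (nat \<Rightarrow> nat) \<Rightarrow> nat \<Rightarrow> nat \<Rightarrow> real" where
  "A_hat T G z i j = (\<Sum>t\<in>{1..T}. of_bool (G t j) * of_bool (z t = i)) / real (group_count T z i)"

text \<open>
  The convention \<open>0 log 0 = 0\<close> holds because \<^const>\<open>ln\<close> is total. A logarithm of 0 occurs below only
  with coefficient 0, and \<^const>\<open>A_hat\<close> is evaluated only at labels used by \<open>z\<close>, so no value at an
  undefined argument of \<^const>\<open>ln\<close> or of division contributes.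
\<close>

definition profile_loglik ::
  "nat \<Rightarrow> nat \<Rightarrow> (nat \<Rightarrow> nat \<Rightarrow> bool) \<Rightarrow> (nat \<Rightarrow> nat) \<Rightarrow> real" where
  "profile_loglik n T G z =
     (\<Sum>t\<in>{1..T}. \<Sum>j\<in>{1..n}.
        of_bool (G t j) * ln (A_hat T G z (z t) j)
        + (1 - of_bool (G t j)) * ln (1 - A_hat T G z (z t) j))"

definition feasible :: "nat \<Rightarrow> nat \<Rightarrow> (nat \<Rightarrow> nat \<Rightarrow> bool) \<Rightarrow> (nat \<Rightarrow> nat) \<Rightarrow> bool" where
  "feasible nL T G z \<longleftrightarrow> (\<forall>t\<in>{1..T}. z t \<in> {0..nL} \<and> (z t = 0 \<or> G t (z t)))"

definition profile_mle ::
  "nat \<Rightarrow> nat \<Rightarrow> nat \<Rightarrow> (nat \<Rightarrow> nat \<Rightarrow> bool) \<Rightarrow> (nat \<Rightarrow> nat) \<Rightarrow> bool" where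
  "profile_mle nL n T G z \<longleftrightarrow> is_arg_max (profile_loglik n T G) (feasible nL T G) z"

definition mislabeled :: "nat \<Rightarrow> (nat \<Rightarrow> nat) \<Rightarrow> (nat \<Rightarrow> nat) \<Rightarrow> nat" where
  "mislabeled T z z' = card {t\<in>{1..T}. z t \<noteq> z' t}"

text \<open>\<open>X k = o\<^sub>p(1)\<close>, where \<open>X k\<close> is a random variable on its own discrete space \<open>P k\<close>.\<close>

definition little_op_one :: "(nat \<Rightarrow> 'a pmf) \<Rightarrow> (nat \<Rightarrow> 'a \<Rightarrow> real) \<Rightarrow> bool" where
  "little_op_one P X \<longleftrightarrow>
     (\<forall>\<epsilon>>0. (\<lambda>k. measure_pmf.prob (P k) {\<omega>. \<bar>X k \<omega>\<bar> > \<epsilon>}) \<longlonglongrightarrow> 0)"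

end

(*
  Hellinger affinity: for a fixed assignment z and a fixed row matrix B, the probability, given the
  true labels z*, that B under z is at least as likely as A under z* is at most
  exp(- sum_{t,j} (B_{z_t,j} - A_{z*_t,j})^2 / 4).  If z puts at least m groups of each of two true
  labels under one label, the sum is at least m d^2 v n / (2 nL), because one row of B cannot be close
  to two rows of A.  There are only (nL+1)^T assignments and (T+1)^(2(nL+1)n) candidate values of the
  profile estimate, so with m of order T a union bound excludes such z.  Every other z induces a
  permutation of the labels up to few groups, and feasibility forces this permutation to be the
  identity: a constant fraction of the groups with a given true label misses any given wrong leader.
*)
theory Submission
  imports Defs
begin

text \<open>The affinity bound holds for a fixed pair of assignment and matrix, whereas
  \<open>A_hat\<close> depends on the data. Because the entries of \<open>A_hat\<close> are count
  ratios, it lies on a finite grid, and no concentration of \<open>A_hat\<close> around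
  \<open>A\<close> has to be shown. The comparison with the true \<open>A\<close> comes from two
  maximizations: the estimator beats the true labels in profile likelihood, and for the true labels
  \<open>A_hat\<close> beats \<open>A\<close>. Taking the square root of the likelihood ratio, not
  its logarithm, keeps entries of \<open>A\<close> at or near 0 and 1 harmless: the affinity is
  always at most 1, while log-likelihoods are unbounded there.

  With \<open>m = \<delta> T\<close> the union bound compares its cost T ln(nL+1) + 2(nL+1) n
  ln(T+1) with a gain of order \<delta> T d^2 v n / nL. The first cost is absorbed because d^2 v n
  tends to infinity, the second because ln T / (d^2 v T) tends to 0.

  The profile likelihood is unchanged when labels are renamed, so it can recover the true partition
  only up to a permutation. This is why the names of the labels must come from feasibility.\<close>

section \<open>Hellinger affinity and the tail of a likelihood ratio\<close>

text \<open>For \<open>p\<close> in the unit interval this is the mass function of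
  \<open>bernoulli_pmf p\<close>; written without it, the expression is plainly affine in
  \<open>p\<close>.\<close>

definition bernoulli_lik :: "real \<Rightarrow> bool \<Rightarrow> real" where
  "bernoulli_lik p b = (if b then p else 1 - p)"

lemma bernoulli_lik_nonneg: "p \<in> {0..1} \<Longrightarrow> 0 \<le> bernoulli_lik p b"
  by (simp add: bernoulli_lik_def)

text \<open>The affinity is 1 minus half the sum of the squared differences of square roots. On the
  unit interval |x - y| is at most 2 |sqrt x - sqrt y|, so each of the two squares is at least (q -
  p)^2 / 4, which leaves 1 - (q - p)^2 / 4.\<close>

lemma bhattacharyya_bernoulli_le:
  fixes p q :: real
  assumes "p \<in> {0..1}" "q \<in> {0..1}"
  shows "sqrt (p * q) + sqrt ((1 - p) * (1 - q)) \<le> exp (- (q - p)\<^sup>2 / 4)"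
proof -
  have *: "(x - y)\<^sup>2 \<le> 4 * (sqrt x - sqrt y)\<^sup>2" if "x \<in> {0..1}" "y \<in> {0..1}" for x y :: real
  proof -
    have "x - y = (sqrt x - sqrt y) * (sqrt x + sqrt y)"
      using that by (simp add: algebra_simps)
    then have "(x - y)\<^sup>2 = (sqrt x - sqrt y)\<^sup>2 * (sqrt x + sqrt y)\<^sup>2"
      by (simp add: power_mult_distrib)
    also have "(sqrt x + sqrt y)\<^sup>2 \<le> 2\<^sup>2"
      using that by (intro power_mono) (auto intro: add_mono[of "sqrt x" 1 "sqrt y" 1, simplified])
    also have "(sqrt x - sqrt y)\<^sup>2 * 2\<^sup>2 = 4 * (sqrt x - sqrt y)\<^sup>2"
      by simp
    finally show ?thesis
      by (simp add: mult_left_mono)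
  qed
  have square: "(sqrt x - sqrt y)\<^sup>2 = x + y - 2 * sqrt (x * y)"
    if "x \<in> {0..1}" "y \<in> {0..1}" for x y :: real
    using that by (simp add: power2_diff real_sqrt_mult)
  have "sqrt (p * q) + sqrt ((1 - p) * (1 - q))
      = 1 - ((sqrt p - sqrt q)\<^sup>2 + (sqrt (1 - p) - sqrt (1 - q))\<^sup>2) / 2"
    using assms by (simp add: square field_simps)
  also have "\<dots> \<le> 1 + (- (q - p)\<^sup>2 / 4)"
    using *[of p q] *[of "1 - p" "1 - q"] assms by (simp add: power2_commute field_simps)
  also have "\<dots> \<le> exp (- (q - p)\<^sup>2 / 4)"
    by (rule exp_ge_add_one_self)
  finally show ?thesis .
qed

lemma expectation_sqrt_lik_ratio_le:
  assumes "p \<in> {0..1}" "q \<in> {0..1}"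
  shows "measure_pmf.expectation (bernoulli_pmf p)
           (\<lambda>b. sqrt (bernoulli_lik q b / bernoulli_lik p b)) \<le> exp (- (q - p)\<^sup>2 / 4)"
proof -
  \<comment> \<open>This includes \<open>x = 0\<close>: an outcome of mass 0 contributes 0 whatever
    value the ratio gets from division by zero.\<close>
  have *: "x * sqrt (y / x) = sqrt (x * y)" if "x \<ge> 0" for x y :: real
    using that by (cases "x = 0") (auto simp: real_sqrt_divide real_sqrt_mult real_div_sqrt field_simps)
  have "measure_pmf.expectation (bernoulli_pmf p)
          (\<lambda>b. sqrt (bernoulli_lik q b / bernoulli_lik p b))
      = sqrt (p * q) + sqrt ((1 - p) * (1 - q))"
    using assms *[of p q] *[of "1 - p" "1 - q"] by (simp add: bernoulli_lik_def mult.commute)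
  then show ?thesis
    using bhattacharyya_bernoulli_le[OF assms] by simp
qed

lemma real_sqrt_prod: "sqrt (prod f A) = (\<Prod>x\<in>A. sqrt (f x))"
  by (induction A rule: infinite_finite_induct) (auto simp: real_sqrt_mult)

text \<open>Markov's inequality for the square root of the likelihood ratio; by independence its
  expectation is a product of Bernoulli affinities. The constant labels \<open>f t\<close> are
  carried along so that the measure has the form of the model conditioned on its labels.\<close>

lemma likelihood_ratio_tail:
  fixes P Q :: "'t \<Rightarrow> 'j \<Rightarrow> real" and f :: "'t \<Rightarrow> 'l"
  assumes I: "finite I" and J: "finite J"
    and P: "\<And>t j. t \<in> I \<Longrightarrow> j \<in> J \<Longrightarrow> P t j \<in> {0..1}"
    and Q: "\<And>t j. t \<in> I \<Longrightarrow> j \<in> J \<Longrightarrow> Q t j \<in> {0..1}"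
  shows "measure_pmf.prob
           (Pi_pmf I dflt (\<lambda>t. map_pmf (Pair (f t)) (Pi_pmf J False (\<lambda>j. bernoulli_pmf (P t j)))))
           {\<omega>. (\<Prod>t\<in>I. \<Prod>j\<in>J. bernoulli_lik (P t j) (snd (\<omega> t) j))
                 \<le> (\<Prod>t\<in>I. \<Prod>j\<in>J. bernoulli_lik (Q t j) (snd (\<omega> t) j))}
         \<le> exp (- (\<Sum>t\<in>I. \<Sum>j\<in>J. (Q t j - P t j)\<^sup>2) / 4)"
    (is "measure_pmf.prob ?M ?E \<le> _")
proof -
  define r where "r t j b = sqrt (bernoulli_lik (Q t j) b / bernoulli_lik (P t j) b)" for t j b
  let ?D = "\<lambda>t. Pi_pmf J False (\<lambda>j. bernoulli_pmf (P t j))"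
  have fin: "finite (set_pmf (?D t))" for t
    using J by (subst set_Pi_pmf) (auto intro!: finite_PiE_dflt)
  have finM: "finite (set_pmf ?M)"
    using I fin by (subst set_Pi_pmf) (auto intro!: finite_PiE_dflt)
  have r0: "0 \<le> r t j b" if "t \<in> I" "j \<in> J" for t j b
    using P[OF that] Q[OF that] by (simp add: r_def bernoulli_lik_nonneg)
  \<comment> \<open>On the support the denominator is positive, so the event really makes the ratio
    at least 1; with a zero denominator the ratio would be 0.\<close>
  have pos: "0 < bernoulli_lik (P t j) (snd (\<omega> t) j)"
    if \<omega>: "\<omega> \<in> set_pmf ?M" and t: "t \<in> I" and j: "j \<in> J" for \<omega> t j
  proof -
    have "snd (\<omega> t) j \<in> set_pmf (bernoulli_pmf (P t j))"
      using \<omega> t j I J by (auto simp: set_Pi_pmf PiE_dflt_def)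
    then have "pmf (bernoulli_pmf (P t j)) (snd (\<omega> t) j) > 0"
      by (rule pmf_positive)
    then show ?thesis
      using P[OF t j] by (cases "snd (\<omega> t) j") (auto simp: bernoulli_lik_def)
  qed
  have le: "indicator ?E \<omega> \<le> (\<Prod>t\<in>I. \<Prod>j\<in>J. r t j (snd (\<omega> t) j))"
    if \<omega>: "\<omega> \<in> set_pmf ?M" for \<omega>
  proof (cases "\<omega> \<in> ?E")
    case True
    have "(\<Prod>t\<in>I. \<Prod>j\<in>J. r t j (snd (\<omega> t) j))
        = sqrt ((\<Prod>t\<in>I. \<Prod>j\<in>J. bernoulli_lik (Q t j) (snd (\<omega> t) j))
              / (\<Prod>t\<in>I. \<Prod>j\<in>J. bernoulli_lik (P t j) (snd (\<omega> t) j)))"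
      by (simp add: r_def prod_dividef real_sqrt_divide real_sqrt_prod)
    moreover have "0 < (\<Prod>t\<in>I. \<Prod>j\<in>J. bernoulli_lik (P t j) (snd (\<omega> t) j))"
      by (intro prod_pos pos[OF \<omega>])
    ultimately show ?thesis
      using True by simp
  next
    case False
    then show ?thesis
      using r0 by (simp add: prod_nonneg)
  qed
  have "measure_pmf.prob ?M ?E = measure_pmf.expectation ?M (indicator ?E)"
    by simp
  also have "\<dots> \<le> measure_pmf.expectation ?M (\<lambda>\<omega>. \<Prod>t\<in>I. \<Prod>j\<in>J. r t j (snd (\<omega> t) j))"
    by (rule integral_mono_AE) (use le in \<open>auto intro!: integrable_measure_pmf_finite finM AE_pmfI
      simp del: measure_pmf.integrable_const\<close>)
  also have "\<dots> = (\<Prod>t\<in>I. measure_pmf.expectation (map_pmf (Pair (f t)) (?D t))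
                      (\<lambda>x. \<Prod>j\<in>J. r t j (snd x j)))"
  proof (rule expectation_prod_Pi_pmf[OF I])
    show "integrable (map_pmf (Pair (f t)) (?D t)) (\<lambda>x. \<Prod>j\<in>J. r t j (snd x j))" for t
      by (rule integrable_measure_pmf_finite) (simp add: fin)
    show "0 \<le> (\<Prod>j\<in>J. r t j (snd x j))" if "t \<in> I" for t x
      using r0 that by (simp add: prod_nonneg)
  qed
  also have "\<dots> = (\<Prod>t\<in>I. measure_pmf.expectation (?D t) (\<lambda>g. \<Prod>j\<in>J. r t j (g j)))"
    by simp
  also have "\<dots> = (\<Prod>t\<in>I. \<Prod>j\<in>J. measure_pmf.expectation (bernoulli_pmf (P t j)) (r t j))"
  proof (rule prod.cong[OF refl], rule expectation_prod_Pi_pmf[OF J])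
    show "integrable (bernoulli_pmf (P t j)) (r t j)" for t j
      by (rule integrable_measure_pmf_finite) simp
  qed (use r0 in simp)
  also have "\<dots> \<le> (\<Prod>t\<in>I. \<Prod>j\<in>J. exp (- (Q t j - P t j)\<^sup>2 / 4))"
  proof -
    have "0 \<le> measure_pmf.expectation (bernoulli_pmf (P t j)) (r t j)
        \<and> measure_pmf.expectation (bernoulli_pmf (P t j)) (r t j) \<le> exp (- (Q t j - P t j)\<^sup>2 / 4)"
      if "t \<in> I" "j \<in> J" for t j
      using expectation_sqrt_lik_ratio_le[OF P[OF that] Q[OF that]] r0[OF that]
      unfolding r_def by (simp add: integral_nonneg_AE del: integral_bernoulli_pmf)
    then show ?thesis
      by (simp add: prod_mono prod_nonneg)
  qed
  also have "\<dots> = exp (- (\<Sum>t\<in>I. \<Sum>j\<in>J. (Q t j - P t j)\<^sup>2) / 4)"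
    by (simp add: I J sum_negf sum_divide_distrib flip: exp_sum)
  finally show ?thesis .
qed

section \<open>The profile estimate maximizes the likelihood for given labels\<close>

lemma profile_loglik_eq:
  "profile_loglik n T G z =
     (\<Sum>t\<in>{1..T}. \<Sum>j\<in>{1..n}. ln (bernoulli_lik (A_hat T G z (z t) j) (G t j)))"
  unfolding profile_loglik_def bernoulli_lik_def by (intro sum.cong refl) auto

lemma A_hat_eq:
  "A_hat T G z i j = real (card {t\<in>{1..T}. z t = i \<and> G t j}) / real (group_count T z i)"
proof -
  have "(\<Sum>t\<in>{1..T}. of_bool (G t j) * of_bool (z t = i))
      = (\<Sum>t\<in>{1..T}. if z t = i \<and> G t j then 1 else (0::real))"
    by (intro sum.cong) auto
  also have "\<dots> = real (card {t\<in>{1..T}. z t = i \<and> G t j})"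
    by (subst sum.inter_filter[symmetric]) auto
  finally show ?thesis by (simp add: A_hat_def)
qed

lemma group_count_split:
  "group_count T z i
     = card {t\<in>{1..T}. z t = i \<and> G t j} + card {t\<in>{1..T}. z t = i \<and> \<not> G t j}"
  unfolding group_count_def
  by (subst card_Un_disjoint[symmetric]) (auto intro!: arg_cong[where f = card])

lemma A_hat_in_unit: "A_hat T G z i j \<in> {0..1}"
  using group_count_split[of T z i G j] unfolding A_hat_eq
  by (auto simp: divide_le_eq_1)

lemma one_minus_A_hat:
  assumes "0 < group_count T z i"
  shows "1 - A_hat T G z i j
     = real (card {t\<in>{1..T}. z t = i \<and> \<not> G t j}) / real (group_count T z i)"
proof -
  have "1 - real a / real m = real b / real m" if "m = a + b" "m > 0" for a b m :: nat
  proof -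
    have "real b = real m - real a"
      using that by simp
    then show ?thesis
      using \<open>m > 0\<close> by (simp add: diff_divide_distrib)
  qed
  from this[OF group_count_split assms] show ?thesis
    unfolding A_hat_eq .
qed

lemma group_count_pos: "t \<in> {1..T} \<Longrightarrow> 0 < group_count T z (z t)"
  unfolding group_count_def by (auto simp: card_gt_0_iff)

text \<open>Group \<open>t\<close> is itself counted in the numerator of the frequency fitted to its
  own observation, so no logarithm of 0 occurs in the profile likelihood.\<close>

lemma bernoulli_lik_A_hat_pos:
  assumes t: "t \<in> {1..T}"
  shows "0 < bernoulli_lik (A_hat T G z (z t) j) (G t j)"
proof (cases "G t j")
  case True
  then have "0 < card {s\<in>{1..T}. z s = z t \<and> G s j}"
    using t by (auto simp: card_gt_0_iff)
  then show ?thesis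
    using True group_count_pos[OF t, of z] by (simp add: bernoulli_lik_def A_hat_eq)
next
  case False
  then have "0 < card {s\<in>{1..T}. z s = z t \<and> \<not> G s j}"
    using t by (auto simp: card_gt_0_iff)
  then have "0 < 1 - A_hat T G z (z t) j"
    unfolding one_minus_A_hat[OF group_count_pos[OF t]]
    by (intro divide_pos_pos) (use group_count_pos[OF t, of z] in auto)
  then show ?thesis
    using False by (simp add: bernoulli_lik_def)
qed

text \<open>In a cluster of size m the frequencies in the denominators cancel the counts, leaving m
  B + m (1 - B) = m. The cluster sizes add up to \<open>T\<close>.\<close>

lemma sum_lik_ratio_le:
  assumes B: "\<And>i. i \<in> z ` {1..T} \<Longrightarrow> B i \<in> {0..1}"
  shows "(\<Sum>t\<in>{1..T}. bernoulli_lik (B (z t)) (G t j) / bernoulli_lik (A_hat T G z (z t) j) (G t j))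
           \<le> real T"
proof -
  let ?g = "\<lambda>t. bernoulli_lik (B (z t)) (G t j) / bernoulli_lik (A_hat T G z (z t) j) (G t j)"
  have "(\<Sum>t\<in>{1..T}. ?g t) = (\<Sum>i\<in>z ` {1..T}. \<Sum>t\<in>{t\<in>{1..T}. z t = i}. ?g t)"
    by (rule sum.group[symmetric]) auto
  also have "\<dots> \<le> (\<Sum>i\<in>z ` {1..T}. real (group_count T z i))"
  proof (intro sum_mono)
    fix i assume i: "i \<in> z ` {1..T}"
    let ?S = "{t\<in>{1..T}. z t = i \<and> G t j}" and ?F = "{t\<in>{1..T}. z t = i \<and> \<not> G t j}"
    let ?m = "real (group_count T z i)" and ?x = "A_hat T G z i j"
    have m: "?m > 0" using group_count_pos i by auto
    \<comment> \<open>Only an inequality, because a value that never occurs in the cluster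
      (\<open>c = 0\<close>) contributes 0 instead of its share.\<close>
    have cancel: "c * (b / (c / ?m)) \<le> ?m * b" if "c \<ge> 0" "b \<ge> 0" for b c
      using that m by (cases "c = 0") (auto simp: field_simps)
    have "(\<Sum>t\<in>{t\<in>{1..T}. z t = i}. ?g t) = (\<Sum>t\<in>?S \<union> ?F. ?g t)"
      by (intro sum.cong) auto
    also have "\<dots> = (\<Sum>t\<in>?S. ?g t) + (\<Sum>t\<in>?F. ?g t)"
      by (intro sum.union_disjoint) auto
    also have "(\<Sum>t\<in>?S. ?g t) = (\<Sum>t\<in>?S. B i / ?x)"
      by (intro sum.cong) (auto simp: bernoulli_lik_def)
    also have "(\<Sum>t\<in>?F. ?g t) = (\<Sum>t\<in>?F. (1 - B i) / (1 - ?x))"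
      by (intro sum.cong) (auto simp: bernoulli_lik_def)
    also have "(\<Sum>t\<in>?S. B i / ?x) + (\<Sum>t\<in>?F. (1 - B i) / (1 - ?x))
        = real (card ?S) * (B i / (real (card ?S) / ?m))
          + real (card ?F) * ((1 - B i) / (real (card ?F) / ?m))"
      using one_minus_A_hat[of T z i G j] m by (simp add: A_hat_eq)
    also have "\<dots> \<le> ?m * B i + ?m * (1 - B i)"
      using B[OF i] by (intro add_mono cancel) auto
    also have "\<dots> = ?m"
      by (simp add: algebra_simps)
    finally show "(\<Sum>t\<in>{t\<in>{1..T}. z t = i}. ?g t) \<le> ?m" .
  qed
  also have "\<dots> = (\<Sum>i\<in>z ` {1..T}. \<Sum>t\<in>{t\<in>{1..T}. z t = i}. 1)"
    by (simp add: group_count_def)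
  also have "\<dots> = (\<Sum>t\<in>{1..T}. 1)"
    by (rule sum.group) auto
  finally show ?thesis by simp
qed

text \<open>By ln x \<le> x - 1 the log-likelihood difference is at most the sum of ratios minus
  their number, which is nonpositive for every node. Positivity is assumed because
  \<open>ln 0 = 0\<close> would score an impossible observation like a certain one.\<close>

lemma profile_loglik_ge:
  assumes B: "\<And>i j. i \<in> z ` {1..T} \<Longrightarrow> j \<in> {1..n} \<Longrightarrow> B i j \<in> {0..1}"
    and pos: "\<And>t j. t \<in> {1..T} \<Longrightarrow> j \<in> {1..n} \<Longrightarrow> 0 < bernoulli_lik (B (z t) j) (G t j)"
  shows "(\<Sum>t\<in>{1..T}. \<Sum>j\<in>{1..n}. ln (bernoulli_lik (B (z t) j) (G t j))) \<le> profile_loglik n T G z"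
proof -
  let ?p = "\<lambda>t j. bernoulli_lik (B (z t) j) (G t j)"
  let ?q = "\<lambda>t j. bernoulli_lik (A_hat T G z (z t) j) (G t j)"
  have "(\<Sum>t\<in>{1..T}. \<Sum>j\<in>{1..n}. ln (?p t j)) - profile_loglik n T G z
      = (\<Sum>j\<in>{1..n}. \<Sum>t\<in>{1..T}. ln (?p t j) - ln (?q t j))"
    unfolding profile_loglik_eq sum_subtractf[symmetric] by (rule sum.swap)
  also have "\<dots> \<le> (\<Sum>j\<in>{1..n}. \<Sum>t\<in>{1..T}. ?p t j / ?q t j - 1)"
  proof (intro sum_mono)
    fix t j assume "j \<in> {1..n}" "t \<in> {1..T}"
    then have "0 < ?p t j" "0 < ?q t j"
      using pos bernoulli_lik_A_hat_pos by auto
    then show "ln (?p t j) - ln (?q t j) \<le> ?p t j / ?q t j - 1"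
      using ln_le_minus_one[of "?p t j / ?q t j"] by (simp add: ln_div)
  qed
  also have "\<dots> \<le> 0"
  proof (rule sum_nonpos)
    fix j assume "j \<in> {1..n}"
    then show "(\<Sum>t\<in>{1..T}. ?p t j / ?q t j - 1) \<le> 0"
      using sum_lik_ratio_le[of z T "\<lambda>i. B i j" G j] B by (simp add: sum_subtractf)
  qed
  finally show ?thesis by simp
qed

section \<open>Law of a single group and a lower tail for counts\<close>

lemma prob_bind_pmf:
  "measure_pmf.prob (bind_pmf M f) E = measure_pmf.expectation M (\<lambda>x. measure_pmf.prob (f x) E)"
proof -
  have "ennreal (measure_pmf.prob (bind_pmf M f) E) = emeasure (measure_pmf (bind_pmf M f)) E"
    by (simp add: measure_pmf.emeasure_eq_measure)
  also have "\<dots> = (\<integral>\<^sup>+y. indicator E y \<partial>bind_pmf M f)"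
    by (rule nn_integral_indicator[symmetric]) simp
  also have "\<dots> = (\<integral>\<^sup>+x. \<integral>\<^sup>+y. indicator E y \<partial>f x \<partial>M)"
    by (rule nn_integral_bind_pmf)
  also have "\<dots> = (\<integral>\<^sup>+x. ennreal (measure_pmf.prob (f x) E) \<partial>measure_pmf M)"
    by (simp add: measure_pmf.emeasure_eq_measure)
  also have "\<dots> = ennreal (measure_pmf.expectation M (\<lambda>x. measure_pmf.prob (f x) E))"
    by (intro nn_integral_eq_integral measure_pmf.integrable_const_bound[where B = 1]) auto
  finally show ?thesis
    by (simp add: integral_nonneg_AE)
qed

lemma prob_bind_pmf_le:
  assumes "\<And>x. x \<in> set_pmf M \<Longrightarrow> measure_pmf.prob (f x) E \<le> c"
  shows "measure_pmf.prob (bind_pmf M f) E \<le> c"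
  unfolding prob_bind_pmf using assms
  by (intro measure_pmf.integral_le_const measure_pmf.integrable_const_bound[where B = 1])
    (auto intro: AE_pmfI)

lemma pmf_label_pmf:
  assumes "hub_params nL n \<rho> A"
  shows "pmf (label_pmf nL \<rho>) i = (if i \<le> nL then \<rho> i else 0)"
  unfolding label_pmf_def
proof (rule pmf_embed_pmf)
  show "0 \<le> (if x \<le> nL then \<rho> x else 0)" for x
    using assms by (simp add: hub_params_def)
  have "(\<integral>\<^sup>+ x. ennreal (if x \<le> nL then \<rho> x else 0) \<partial>count_space UNIV)
      = (\<Sum>x\<in>{0..nL}. ennreal (if x \<le> nL then \<rho> x else 0))"
    by (rule nn_integral_count_space') auto
  also have "\<dots> = (\<Sum>x\<in>{0..nL}. ennreal (\<rho> x))"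
    by (intro sum.cong) auto
  also have "\<dots> = ennreal (\<Sum>x\<in>{0..nL}. \<rho> x)"
    using assms by (intro sum_ennreal) (simp add: hub_params_def)
  also have "\<dots> = 1"
    using assms by (simp add: hub_params_def)
  finally show "(\<integral>\<^sup>+ x. ennreal (if x \<le> nL then \<rho> x else 0) \<partial>count_space UNIV) = 1" .
qed

lemma prob_group_pmf_label:
  assumes "hub_params nL n \<rho> A" and "a \<le> nL"
  shows "measure_pmf.prob (group_pmf nL n \<rho> A) {x. fst x = a} = \<rho> a"
proof -
  have "map_pmf fst (group_pmf nL n \<rho> A) = label_pmf nL \<rho>"
    by (simp add: group_pmf_def map_bind_pmf pmf.map_comp o_def bind_return_pmf' map_pmf_const)
  then have "measure_pmf.prob (group_pmf nL n \<rho> A) (fst -` {a}) = pmf (label_pmf nL \<rho>) a"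
    by (metis measure_map_pmf pmf.rep_eq)
  moreover have "fst -` {a} = {x. fst x = a}" by auto
  ultimately show ?thesis
    using assms by (metis pmf_label_pmf)
qed

text \<open>Keeps only the component of label \<open>a\<close> in the mixture over labels. Such
  groups are the ones that feasibility later bars from estimated label \<open>i\<close>.\<close>

lemma prob_group_pmf_label_absent:
  assumes hub: "hub_params nL n \<rho> A" and a: "a \<le> nL" and i: "i \<in> {1..n}"
  shows "\<rho> a * (1 - A a i) \<le> measure_pmf.prob (group_pmf nL n \<rho> A) {x. fst x = a \<and> \<not> snd x i}"
proof -
  let ?E = "{x :: nat \<times> (nat \<Rightarrow> bool). fst x = a \<and> \<not> snd x i}"
  let ?D = "Pi_pmf {1..n} False (\<lambda>j. bernoulli_pmf (A a j))"
  let ?g = "\<lambda>l. measure_pmf.prob (map_pmf (Pair l) (Pi_pmf {1..n} False (\<lambda>j. bernoulli_pmf (A l j)))) ?E"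
  have A: "0 \<le> A a i" "A a i \<le> 1"
    using hub a i by (auto simp: hub_params_def)
  have "?g a = measure_pmf.prob ?D ((\<lambda>g. g i) -` {False})"
    by (simp add: vimage_def)
  also have "\<dots> = pmf (map_pmf (\<lambda>g. g i) ?D) False"
    by (simp add: pmf_map)
  also have "\<dots> = 1 - A a i"
    using A i by (simp add: Pi_pmf_component)
  finally have ga: "?g a = 1 - A a i" .
  have "\<rho> a * (1 - A a i) = measure_pmf.expectation (label_pmf nL \<rho>) (\<lambda>l. indicator {a} l * (1 - A a i))"
    using a pmf_label_pmf[OF hub, of a] by (simp add: pmf.rep_eq)
  also have "\<dots> \<le> measure_pmf.expectation (label_pmf nL \<rho>) ?g"
  proof (rule integral_mono)
    show "integrable (label_pmf nL \<rho>) (\<lambda>l. indicator {a} l * (1 - A a i))"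
      using A by (intro measure_pmf.integrable_const_bound[where B = 1]) (auto simp: indicator_def)
    show "integrable (label_pmf nL \<rho>) ?g"
      by (intro measure_pmf.integrable_const_bound[where B = 1]) auto
    show "indicator {a} l * (1 - A a i) \<le> ?g l" for l
      using ga by (cases "l = a") auto
  qed
  finally show ?thesis
    by (simp add: group_pmf_def prob_bind_pmf)
qed

text \<open>A Chernoff bound with weight 1/2 per success. The mean weight of one trial is at most
  exp(-q/2), while on the event the product of weights is at least exp(-qN/4), N being the number of
  trials; Markov leaves exp(qN/4 - qN/2).\<close>

lemma Pi_pmf_count_lower_tail:
  assumes I: "finite I" and q: "q \<le> measure_pmf.prob p {x. Q x}"
  shows "measure_pmf.prob (Pi_pmf I dflt (\<lambda>_. p))
           {\<omega>. real (card {t\<in>I. Q (\<omega> t)}) < q * real (card I) / 4} \<le> exp (- (q * real (card I)) / 4)"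
    (is "measure_pmf.prob ?M ?E \<le> _")
proof -
  define w where "w x = (if Q x then 1 / 2 else 1 :: real)" for x
  let ?N = "real (card I)"
  have int_w: "integrable (measure_pmf p) w" unfolding w_def
    by (intro measure_pmf.integrable_const_bound[where B = 1]) auto
  have prod_w: "(\<Prod>t\<in>I. w (\<omega> t)) = (1 / 2) ^ card {t\<in>I. Q (\<omega> t)}" for \<omega>
    unfolding w_def by (subst prod.inter_filter[OF I, symmetric]) simp
  have w_le: "0 \<le> (\<Prod>t\<in>I. w (\<omega> t))" "(\<Prod>t\<in>I. w (\<omega> t)) \<le> 1" for \<omega>
    by (simp_all add: prod_w power_le_one)
  have "1 / 2 = exp (- ln 2 :: real)"
    by (simp add: exp_minus)
  also have "exp (- ln 2 :: real) \<ge> exp (- 1)"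
    using ln_2_less_1 by simp
  finally have half: "exp (- 1) \<le> (1 / 2 :: real)" .
  have le: "indicator ?E \<omega> \<le> exp (q * ?N / 4) * (\<Prod>t\<in>I. w (\<omega> t))" for \<omega>
  proof (cases "\<omega> \<in> ?E")
    case True
    let ?c = "card {t\<in>I. Q (\<omega> t)}"
    have "1 \<le> exp (q * ?N / 4) * exp (- real ?c)"
      using True by (simp flip: exp_add)
    also have "exp (- real ?c) = exp (- 1) ^ ?c"
      by (simp flip: exp_of_nat_mult)
    also have "exp (q * ?N / 4) * exp (- 1) ^ ?c \<le> exp (q * ?N / 4) * (1 / 2) ^ ?c"
      using half by (intro mult_left_mono power_mono) auto
    finally show ?thesis
      using True by (simp add: prod_w)
  next
    case False
    then show ?thesis
      using w_le by simp
  qed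
  have E_w: "measure_pmf.expectation p w \<le> exp (- q / 2)"
  proof -
    have int: "integrable (measure_pmf p) (\<lambda>x. indicator {x. Q x} x / 2 :: real)"
      by (intro measure_pmf.integrable_const_bound[where B = 1]) (auto simp: indicator_def)
    have "w = (\<lambda>x. 1 - indicator {x. Q x} x / 2)"
      by (auto simp: w_def indicator_def)
    then have "measure_pmf.expectation p w = 1 - measure_pmf.prob p {x. Q x} / 2"
      using Bochner_Integration.integral_diff[OF _ int, of "\<lambda>_. 1"] by simp
    also have "\<dots> \<le> 1 + (- q / 2)"
      using q by simp
    also have "\<dots> \<le> exp (- q / 2)"
      by (rule exp_ge_add_one_self)
    finally show ?thesis .
  qed
  have "measure_pmf.prob ?M ?E = measure_pmf.expectation ?M (indicator ?E)"
    by simp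
  also have "\<dots> \<le> measure_pmf.expectation ?M (\<lambda>\<omega>. exp (q * ?N / 4) * (\<Prod>t\<in>I. w (\<omega> t)))"
  proof (rule integral_mono)
    show "integrable ?M (indicator ?E :: _ \<Rightarrow> real)"
      by (intro measure_pmf.integrable_const_bound[where B = 1]) auto
    show "integrable ?M (\<lambda>\<omega>. exp (q * ?N / 4) * (\<Prod>t\<in>I. w (\<omega> t)))"
      by (intro integrable_mult_right integrable_prod_Pi_pmf I int_w)
  qed (rule le)
  also have "\<dots> = exp (q * ?N / 4) * measure_pmf.expectation ?M (\<lambda>\<omega>. \<Prod>t\<in>I. w (\<omega> t))"
    by simp
  also have "measure_pmf.expectation ?M (\<lambda>\<omega>. \<Prod>t\<in>I. w (\<omega> t)) = measure_pmf.expectation p w ^ card I"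
    by (subst expectation_prod_Pi_pmf[OF I int_w]) (auto simp: w_def)
  also have "exp (q * ?N / 4) * measure_pmf.expectation p w ^ card I
      \<le> exp (q * ?N / 4) * exp (- q / 2) ^ card I"
    using E_w by (intro mult_left_mono power_mono) (auto simp: w_def intro!: integral_nonneg_AE)
  also have "\<dots> = exp (- (q * ?N) / 4)"
  proof -
    have "exp (q * ?N / 4) * exp (- q / 2) ^ card I = exp (q * ?N / 4 + ?N * (- q / 2))"
      by (simp only: exp_of_nat_mult exp_add)
    also have "q * ?N / 4 + ?N * (- q / 2) = - (q * ?N) / 4"
      by simp
    finally show ?thesis .
  qed
  finally show ?thesis .
qed

section \<open>Permutations hidden in the confusion matrix\<close>

text \<open>
  A label of the true model is matched to the estimated label that absorbs at least \<open>m\<close> of its groups.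
  If no estimated label absorbs two true labels, the matching is a permutation, and a nontrivial
  permutation sends some true label to a wrong leader.
\<close>

lemma confusion_matrix_cases:
  fixes N :: "nat \<Rightarrow> nat \<Rightarrow> real"
  assumes row: "\<And>a. a \<le> K \<Longrightarrow> (\<Sum>b\<le>K. N a b) > (real K + 1) * m"
    and col: "\<And>a a' b. a \<le> K \<Longrightarrow> a' \<le> K \<Longrightarrow> b \<le> K \<Longrightarrow> m \<le> N a b \<Longrightarrow> m \<le> N a' b \<Longrightarrow> a = a'"
  obtains (diagonal) "\<And>a b. a \<le> K \<Longrightarrow> b \<le> K \<Longrightarrow> a \<noteq> b \<Longrightarrow> N a b < m"
  | (wrong_leader) a b where "a \<le> K" "b \<le> K" "b \<noteq> 0" "b \<noteq> a"
      "\<And>b'. b' \<le> K \<Longrightarrow> b' \<noteq> b \<Longrightarrow> N a b' < m"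
proof -
  have "\<exists>b\<le>K. m \<le> N a b" if "a \<le> K" for a
  proof (rule ccontr)
    assume "\<not> (\<exists>b\<le>K. m \<le> N a b)"
    then have "(\<Sum>b\<le>K. N a b) \<le> (\<Sum>b\<le>K. m)"
      by (intro sum_mono) force
    with row[OF that] show False by (simp add: algebra_simps)
  qed
  then obtain \<sigma> where \<sigma>: "\<And>a. a \<le> K \<Longrightarrow> \<sigma> a \<le> K \<and> m \<le> N a (\<sigma> a)"
    by metis
  have inj: "inj_on \<sigma> {..K}"
    using \<sigma> col by (intro inj_onI) (metis atMost_iff)
  have surj: "\<sigma> ` {..K} = {..K}"
    using inj \<sigma> by (intro endo_inj_surj) auto
  \<comment> \<open>As \<open>\<sigma>\<close> is onto, column \<open>b\<close> already has a large
    entry in the row \<open>a'\<close> with \<open>\<sigma> a' = b\<close>; a second one in row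
    \<open>a\<close> would contradict \<open>col\<close>.\<close>
  have off: "N a b < m" if "a \<le> K" "b \<le> K" "b \<noteq> \<sigma> a" for a b
  proof (rule ccontr)
    assume "\<not> N a b < m"
    moreover obtain a' where "a' \<le> K" "b = \<sigma> a'"
      using surj \<open>b \<le> K\<close> by (metis atMost_iff imageE)
    ultimately show False
      using col[of a a' b] \<sigma> that by (metis not_less)
  qed
  show ?thesis
  proof (cases "\<forall>a\<le>K. \<sigma> a = a")
    case True
    then show ?thesis
      using off diagonal by metis
  next
    case False
    then obtain a where a: "a \<le> K" "\<sigma> a \<noteq> a" by blast
    \<comment> \<open>If the moved label \<open>a\<close> goes to 0, it does not serve as witness,
      but then by injectivity label 0 is itself moved to a leader.\<close>
    have "\<exists>a\<le>K. \<sigma> a \<noteq> 0 \<and> \<sigma> a \<noteq> a"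
    proof (cases "\<sigma> a = 0")
      case True
      then have "\<sigma> 0 \<noteq> 0"
        using a inj by (metis atMost_iff inj_onD le0)
      then show ?thesis by auto
    qed (use a in auto)
    then show ?thesis
      using wrong_leader \<sigma> off by metis
  qed
qed

section \<open>Conditioning on the labels and almost sure properties\<close>

text \<open>Draws all labels before all observations. Given the labels, the observations are
  independent Bernoulli variables, as the likelihood ratio bound requires.\<close>

lemma hub_pmf_conv_bind:
  "hub_pmf nL n T \<rho> A =
     bind_pmf (Pi_pmf {1..T} 0 (\<lambda>_. label_pmf nL \<rho>)) (\<lambda>l.
       Pi_pmf {1..T} (0, \<lambda>_. False) (\<lambda>t.
         map_pmf (Pair (l t)) (Pi_pmf {1..n} False (\<lambda>j. bernoulli_pmf (A (l t) j)))))"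
  unfolding hub_pmf_def group_pmf_def
  by (rule Pi_pmf_bind) simp

lemma set_pmf_hub_pmf:
  assumes hub: "hub_params nL n \<rho> A" and \<omega>: "\<omega> \<in> set_pmf (hub_pmf nL n T \<rho> A)" and t: "t \<in> {1..T}"
  shows "latent \<omega> t \<in> {0..nL}"
    and "j \<in> {1..n} \<Longrightarrow> 0 < bernoulli_lik (A (latent \<omega> t) j) (observed \<omega> t j)"
proof -
  have "\<omega> t \<in> set_pmf (group_pmf nL n \<rho> A)"
    using \<omega> t by (auto simp: hub_pmf_def set_Pi_pmf PiE_dflt_def)
  then have l: "latent \<omega> t \<in> set_pmf (label_pmf nL \<rho>)"
    and g: "observed \<omega> t \<in> set_pmf (Pi_pmf {1..n} False (\<lambda>j. bernoulli_pmf (A (latent \<omega> t) j)))"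
    by (auto simp: group_pmf_def latent_def observed_def)
  show lat: "latent \<omega> t \<in> {0..nL}"
    using l by (auto simp: set_pmf_iff pmf_label_pmf[OF hub] split: if_splits)
  show "0 < bernoulli_lik (A (latent \<omega> t) j) (observed \<omega> t j)" if j: "j \<in> {1..n}"
  proof -
    have A: "0 \<le> A (latent \<omega> t) j" "A (latent \<omega> t) j \<le> 1"
      using hub lat j by (auto simp: hub_params_def)
    have "observed \<omega> t j \<in> set_pmf (bernoulli_pmf (A (latent \<omega> t) j))"
      using g j by (auto simp: set_Pi_pmf PiE_dflt_def)
    then have "0 < pmf (bernoulli_pmf (A (latent \<omega> t) j)) (observed \<omega> t j)"
      by (rule pmf_positive)
    then show ?thesis
      using A by (cases "observed \<omega> t j") (auto simp: bernoulli_lik_def)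
  qed
qed

text \<open>Since \<open>A i i = 1\<close>, a leader is almost surely present in its own groups.
  Hence the true labels compete in the maximization defining the estimator.\<close>

lemma feasible_latent:
  assumes hub: "hub_params nL n \<rho> A" and \<omega>: "\<omega> \<in> set_pmf (hub_pmf nL n T \<rho> A)"
  shows "feasible nL T (observed \<omega>) (latent \<omega>)"
  unfolding feasible_def
proof (intro ballI conjI)
  fix t assume t: "t \<in> {1..T}"
  show lat: "latent \<omega> t \<in> {0..nL}"
    by (rule set_pmf_hub_pmf[OF hub \<omega> t])
  show "latent \<omega> t = 0 \<or> observed \<omega> t (latent \<omega> t)"
  proof (rule disjCI)
    assume "\<not> observed \<omega> t (latent \<omega> t)"
    moreover have "latent \<omega> t \<noteq> 0 \<Longrightarrow> A (latent \<omega> t) (latent \<omega> t) = 1 \<and> latent \<omega> t \<in> {1..n}"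
      using hub lat by (auto simp: hub_params_def)
    ultimately show "latent \<omega> t = 0"
      using set_pmf_hub_pmf(2)[OF hub \<omega> t, of "latent \<omega> t"] by (force simp: bernoulli_lik_def)
  qed
qed

section \<open>Assignments that merge two true labels\<close>

definition confusion :: "nat \<Rightarrow> (nat \<Rightarrow> nat) \<Rightarrow> (nat \<Rightarrow> nat) \<Rightarrow> nat \<Rightarrow> nat \<Rightarrow> nat" where
  "confusion T l z a b = card {t\<in>{1..T}. l t = a \<and> z t = b}"

text \<open>Depends on the two labelings only, so it becomes deterministic once the labels are
  conditioned on. The threshold is real because it will be a fraction of \<open>T\<close>.\<close>

definition merges :: "nat \<Rightarrow> nat \<Rightarrow> real \<Rightarrow> (nat \<Rightarrow> nat) \<Rightarrow> (nat \<Rightarrow> nat) \<Rightarrow> bool" where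
  "merges nL T m l z \<longleftrightarrow> (\<exists>a\<le>nL. \<exists>a'\<le>nL. \<exists>b. a \<noteq> a' \<and>
     m \<le> real (confusion T l z a b) \<and> m \<le> real (confusion T l z a' b))"

lemma merges_cong:
  assumes "\<And>t. t \<in> {1..T} \<Longrightarrow> l t = l' t" "\<And>t. t \<in> {1..T} \<Longrightarrow> z t = z' t"
  shows "merges nL T m l z = merges nL T m l' z'"
proof -
  have "confusion T l z a b = confusion T l' z' a b" for a b
    unfolding confusion_def using assms by (intro arg_cong[where f = card]) auto
  then show ?thesis by (simp add: merges_def)
qed

text \<open>One estimated row cannot be close to two distinct rows of \<open>A\<close>.\<close>

lemma merges_imp_distance:
  fixes A B :: "nat \<Rightarrow> nat \<Rightarrow> real"
  assumes sep: "\<And>a a'. a \<le> nL \<Longrightarrow> a' \<le> nL \<Longrightarrow> a \<noteq> a' \<Longrightarrow> D \<le> (\<Sum>j\<in>{1..n}. (A a j - A a' j)\<^sup>2)"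
    and D: "0 \<le> D" and m: "merges nL T m l z"
  shows "m * D / 2 \<le> (\<Sum>t\<in>{1..T}. \<Sum>j\<in>{1..n}. (B (z t) j - A (l t) j)\<^sup>2)"
proof -
  let ?s = "\<lambda>t. \<Sum>j\<in>{1..n}. (B (z t) j - A (l t) j)\<^sup>2"
  let ?d = "\<lambda>a b. \<Sum>j\<in>{1..n}. (B b j - A a j)\<^sup>2"
  obtain a a' b where ab: "a \<le> nL" "a' \<le> nL" "a \<noteq> a'"
    "m \<le> real (confusion T l z a b)" "m \<le> real (confusion T l z a' b)"
    using m by (auto simp: merges_def)
  let ?S = "\<lambda>a. {t\<in>{1..T}. l t = a \<and> z t = b}"
  have S: "m * ?d c b \<le> (\<Sum>t\<in>?S c. ?s t)" if "m \<le> real (confusion T l z c b)" for c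
  proof -
    have "(\<Sum>t\<in>?S c. ?s t) = (\<Sum>t\<in>?S c. ?d c b)"
      by (intro sum.cong) auto
    also have "\<dots> = real (confusion T l z c b) * ?d c b"
      by (simp add: confusion_def)
    finally have eq: "(\<Sum>t\<in>?S c. ?s t) = real (confusion T l z c b) * ?d c b" .
    show ?thesis
      unfolding eq by (rule mult_right_mono[OF that]) (simp add: sum_nonneg)
  qed
  show ?thesis
  proof (cases "0 \<le> m")
    case True
    have "D \<le> (\<Sum>j\<in>{1..n}. (A a j - A a' j)\<^sup>2)"
      using sep ab by auto
    \<comment> \<open>(x - y)^2 \<le> 2 x^2 + 2 y^2 with both deviations taken from the common row
      \<open>B b\<close>; the 2 is the source of the factor 1/2 in the conclusion.\<close>
    also have "\<dots> \<le> (\<Sum>j\<in>{1..n}. 2 * (B b j - A a j)\<^sup>2 + 2 * (B b j - A a' j)\<^sup>2)"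
    proof (rule sum_mono)
      fix j
      have "0 \<le> ((B b j - A a j) + (B b j - A a' j))\<^sup>2" by simp
      then show "(A a j - A a' j)\<^sup>2 \<le> 2 * (B b j - A a j)\<^sup>2 + 2 * (B b j - A a' j)\<^sup>2"
        by (simp add: power2_eq_square algebra_simps)
    qed
    also have "\<dots> = 2 * (?d a b + ?d a' b)"
      by (simp add: sum.distrib sum_distrib_left)
    finally have "m * D \<le> m * (2 * (?d a b + ?d a' b))"
      using True by (intro mult_left_mono)
    then have "m * D / 2 \<le> m * ?d a b + m * ?d a' b"
      by (simp add: algebra_simps)
    also have "\<dots> \<le> (\<Sum>t\<in>?S a. ?s t) + (\<Sum>t\<in>?S a'. ?s t)"
      using S ab by (intro add_mono) auto
    also have "\<dots> = (\<Sum>t\<in>?S a \<union> ?S a'. ?s t)"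
      using ab by (intro sum.union_disjoint[symmetric]) auto
    also have "\<dots> \<le> (\<Sum>t\<in>{1..T}. ?s t)"
      by (intro sum_mono2) (auto intro: sum_nonneg)
    finally show ?thesis .
  next
    case False
    then have "m * D / 2 \<le> 0"
      using D by (simp add: mult_nonpos_nonneg)
    also have "0 \<le> (\<Sum>t\<in>{1..T}. ?s t)"
      by (intro sum_nonneg) auto
    finally show ?thesis .
  qed
qed

text \<open>Conditionally on the labels, either \<open>z\<close> merges and the tail bound applies
  with squared distance at least \<open>m * D / 2\<close>, giving the exponent
  \<open>m * D / 8\<close>, or the event is null. The bound is uniform in the labels and survives
  averaging.\<close>

lemma prob_merges_lik_le:
  fixes A B :: "nat \<Rightarrow> nat \<Rightarrow> real"
  assumes hub: "hub_params nL n \<rho> A"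
    and sep: "\<And>a a'. a \<le> nL \<Longrightarrow> a' \<le> nL \<Longrightarrow> a \<noteq> a' \<Longrightarrow> D \<le> (\<Sum>j\<in>{1..n}. (A a j - A a' j)\<^sup>2)"
    and D: "0 \<le> D"
    and B: "\<And>t j. t \<in> {1..T} \<Longrightarrow> j \<in> {1..n} \<Longrightarrow> B (z t) j \<in> {0..1}"
  shows "measure_pmf.prob (hub_pmf nL n T \<rho> A)
           {\<omega>. merges nL T m (latent \<omega>) z \<and>
             (\<Prod>t\<in>{1..T}. \<Prod>j\<in>{1..n}. bernoulli_lik (A (latent \<omega> t) j) (observed \<omega> t j))
             \<le> (\<Prod>t\<in>{1..T}. \<Prod>j\<in>{1..n}. bernoulli_lik (B (z t) j) (observed \<omega> t j))}
         \<le> exp (- (m * D) / 8)"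
    (is "measure_pmf.prob _ ?E \<le> _")
  unfolding hub_pmf_conv_bind
proof (rule prob_bind_pmf_le)
  fix l assume l: "l \<in> set_pmf (Pi_pmf {1..T} 0 (\<lambda>_. label_pmf nL \<rho>))"
  let ?M = "Pi_pmf {1..T} (0, \<lambda>_. False) (\<lambda>t.
    map_pmf (Pair (l t)) (Pi_pmf {1..n} False (\<lambda>j. bernoulli_pmf (A (l t) j))))"
  let ?L = "{\<omega>. (\<Prod>t\<in>{1..T}. \<Prod>j\<in>{1..n}. bernoulli_lik (A (l t) j) (snd (\<omega> t) j))
                 \<le> (\<Prod>t\<in>{1..T}. \<Prod>j\<in>{1..n}. bernoulli_lik (B (z t) j) (snd (\<omega> t) j))}"
  have lat: "latent \<omega> t = l t" if "\<omega> \<in> set_pmf ?M" "t \<in> {1..T}" for \<omega> t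
    using that by (auto simp: set_Pi_pmf PiE_dflt_def latent_def)
  have l_le: "l t \<le> nL" if "t \<in> {1..T}" for t
    using l that by (auto simp: set_Pi_pmf PiE_dflt_def set_pmf_iff pmf_label_pmf[OF hub] split: if_splits)
  have A: "A (l t) j \<in> {0..1}" if "t \<in> {1..T}" "j \<in> {1..n}" for t j
    using hub l_le[OF that(1)] that by (auto simp: hub_params_def)
  show "measure_pmf.prob ?M ?E \<le> exp (- (m * D) / 8)"
  proof (cases "merges nL T m l z")
    case True
    have "measure_pmf.prob ?M ?E \<le> measure_pmf.prob ?M ?L"
    proof (rule measure_pmf.finite_measure_mono_AE, rule AE_pmfI, rule impI)
      fix \<omega> assume \<omega>: "\<omega> \<in> set_pmf ?M" "\<omega> \<in> ?E"
      have "(\<Prod>t\<in>{1..T}. \<Prod>j\<in>{1..n}. bernoulli_lik (A (latent \<omega> t) j) (observed \<omega> t j))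
          = (\<Prod>t\<in>{1..T}. \<Prod>j\<in>{1..n}. bernoulli_lik (A (l t) j) (observed \<omega> t j))"
        by (rule prod.cong[OF refl]) (simp only: lat[OF \<omega>(1)])
      then show "\<omega> \<in> ?L"
        using \<omega>(2) by (simp add: observed_def)
    qed simp
    also have "\<dots> \<le> exp (- (\<Sum>t\<in>{1..T}. \<Sum>j\<in>{1..n}. (B (z t) j - A (l t) j)\<^sup>2) / 4)"
      using A B by (intro likelihood_ratio_tail) auto
    also have "\<dots> \<le> exp (- (m * D) / 8)"
    proof -
      have "m * D / 2 \<le> (\<Sum>t\<in>{1..T}. \<Sum>j\<in>{1..n}. (B (z t) j - A (l t) j)\<^sup>2)"
        by (rule merges_imp_distance[where nL = nL, OF _ D True]) (rule sep)
      then show ?thesis by (simp add: mult.commute)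
    qed
    finally show ?thesis .
  next
    case False
    have "measure_pmf.prob ?M ?E \<le> measure_pmf.prob ?M {}"
    proof (rule measure_pmf.finite_measure_mono_AE, rule AE_pmfI, rule impI)
      fix \<omega> assume \<omega>: "\<omega> \<in> set_pmf ?M" "\<omega> \<in> ?E"
      then have "merges nL T m (latent \<omega>) z" by simp
      also have "merges nL T m (latent \<omega>) z = merges nL T m l z"
        using lat[OF \<omega>(1)] by (intro merges_cong) auto
      finally show "\<omega> \<in> {}"
        using False by simp
    qed simp
    also have "\<dots> \<le> exp (- (m * D) / 8)" by simp
    finally show ?thesis .
  qed
qed

lemma profile_loglik_cong:
  assumes "\<And>t. t \<in> {1..T} \<Longrightarrow> z t = z' t"
  shows "profile_loglik n T G z = profile_loglik n T G z'"
proof -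
  have "{t\<in>{1..T}. z t = i} = {t\<in>{1..T}. z' t = i}" for i
    using assms by auto
  then have "A_hat T G z i j = A_hat T G z' i j" for i j
    unfolding A_hat_def group_count_def using assms by (auto intro!: arg_cong2[where f = "(/)"] sum.cong)
  then show ?thesis
    unfolding profile_loglik_def using assms by (intro sum.cong refl) auto
qed

lemma profile_loglik_eq_ln_prod:
  "profile_loglik n T G z =
     ln (\<Prod>t\<in>{1..T}. \<Prod>j\<in>{1..n}. bernoulli_lik (A_hat T G z (z t) j) (G t j))"
proof -
  have "ln (\<Prod>t\<in>{1..T}. \<Prod>j\<in>{1..n}. bernoulli_lik (A_hat T G z (z t) j) (G t j))
      = (\<Sum>t\<in>{1..T}. ln (\<Prod>j\<in>{1..n}. bernoulli_lik (A_hat T G z (z t) j) (G t j)))"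
    by (intro ln_prod finite_atLeastAtMost less_imp_neq[THEN not_sym] prod_pos bernoulli_lik_A_hat_pos)
  also have "\<dots> = profile_loglik n T G z"
    unfolding profile_loglik_eq
    by (intro sum.cong refl ln_prod finite_atLeastAtMost less_imp_neq[THEN not_sym] bernoulli_lik_A_hat_pos)
  finally show ?thesis by simp
qed

text \<open>The likelihood of \<open>A\<close> is at most the profile likelihood of the true labels,
  which is at most that of \<open>z\<close>. This puts the nonrandom \<open>A\<close> on the left,
  as in the likelihood ratio bound.\<close>

lemma lik_le_profile_lik:
  assumes hub: "hub_params nL n \<rho> A" and \<omega>: "\<omega> \<in> set_pmf (hub_pmf nL n T \<rho> A)"
    and le: "profile_loglik n T (observed \<omega>) (latent \<omega>) \<le> profile_loglik n T (observed \<omega>) z"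
  shows "(\<Prod>t\<in>{1..T}. \<Prod>j\<in>{1..n}. bernoulli_lik (A (latent \<omega> t) j) (observed \<omega> t j))
    \<le> (\<Prod>t\<in>{1..T}. \<Prod>j\<in>{1..n}.
          bernoulli_lik (A_hat T (observed \<omega>) z (z t) j) (observed \<omega> t j))"
    (is "?P \<le> ?Q")
proof -
  note pos = set_pmf_hub_pmf(2)[OF hub \<omega>]
  have "ln ?P = (\<Sum>t\<in>{1..T}. ln (\<Prod>j\<in>{1..n}. bernoulli_lik (A (latent \<omega> t) j) (observed \<omega> t j)))"
    by (intro ln_prod finite_atLeastAtMost less_imp_neq[THEN not_sym] prod_pos pos)
  also have "\<dots> = (\<Sum>t\<in>{1..T}. \<Sum>j\<in>{1..n}. ln (bernoulli_lik (A (latent \<omega> t) j) (observed \<omega> t j)))"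
    by (intro sum.cong refl ln_prod finite_atLeastAtMost less_imp_neq[THEN not_sym] pos)
  also have "\<dots> \<le> profile_loglik n T (observed \<omega>) (latent \<omega>)"
  proof (rule profile_loglik_ge)
    show "A i j \<in> {0..1}" if "i \<in> latent \<omega> ` {1..T}" "j \<in> {1..n}" for i j
      using set_pmf_hub_pmf(1)[OF hub \<omega>] hub that by (auto simp: hub_params_def)
  qed (rule pos)
  also have "\<dots> \<le> ln ?Q"
    using le unfolding profile_loglik_eq_ln_prod .
  finally have "ln ?P \<le> ln ?Q" .
  moreover have "0 < ?P" by (intro prod_pos pos)
  moreover have "0 < ?Q" by (intro prod_pos bernoulli_lik_A_hat_pos)
  ultimately show ?thesis by simp
qed

text \<open>
  A union bound over the label assignments and over the possible values of \<^const>\<open>A_hat\<close>, whose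
  entries are fractions with numerator and denominator at most \<open>T\<close>.
\<close>

lemma prob_merges_profile_le:
  fixes A :: "nat \<Rightarrow> nat \<Rightarrow> real"
  assumes hub: "hub_params nL n \<rho> A"
    and sep: "\<And>a a'. a \<le> nL \<Longrightarrow> a' \<le> nL \<Longrightarrow> a \<noteq> a' \<Longrightarrow> D \<le> (\<Sum>j\<in>{1..n}. (A a j - A a' j)\<^sup>2)"
    and D: "0 \<le> D"
  shows "measure_pmf.prob (hub_pmf nL n T \<rho> A)
           {\<omega>. \<exists>z\<in>{1..T} \<rightarrow>\<^sub>E {0..nL}. merges nL T m (latent \<omega>) z \<and>
             profile_loglik n T (observed \<omega>) (latent \<omega>) \<le> profile_loglik n T (observed \<omega>) z}
         \<le> (real nL + 1) ^ T * (real T + 1) ^ (2 * ((nL + 1) * n)) * exp (- (m * D) / 8)"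
    (is "measure_pmf.prob ?M ?E \<le> _")
proof -
  define F where "F = (\<lambda>(a, b). real a / real b) ` ({0..T} \<times> {0..T}) \<inter> {0..1}"
  define Z where "Z = {1..T} \<rightarrow>\<^sub>E {0..nL}"
  define H where "H = ({0..nL} \<times> {1..n}) \<rightarrow>\<^sub>E F"
  define X where "X z B = {\<omega>. merges nL T m (latent \<omega>) z \<and>
      (\<Prod>t\<in>{1..T}. \<Prod>j\<in>{1..n}. bernoulli_lik (A (latent \<omega> t) j) (observed \<omega> t j))
      \<le> (\<Prod>t\<in>{1..T}. \<Prod>j\<in>{1..n}. bernoulli_lik (B (z t, j)) (observed \<omega> t j))}"
    for z :: "nat \<Rightarrow> nat" and B :: "nat \<times> nat \<Rightarrow> real"
  have finF: "finite F" by (simp add: F_def)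
  have "card F \<le> card ((\<lambda>(a, b). real a / real b) ` ({0..T} \<times> {0..T}))"
    unfolding F_def by (intro card_mono) auto
  also have "\<dots> \<le> card ({0..T} \<times> {0..T})"
    by (intro card_image_le) auto
  also have "\<dots> = (T + 1)\<^sup>2"
    by (simp add: power2_eq_square)
  finally have cardF: "card F \<le> (T + 1)\<^sup>2" .
  have finZ: "finite Z" "card Z = (nL + 1) ^ T"
    by (auto simp: Z_def card_PiE intro!: finite_PiE)
  have finH: "finite H" "card H = card F ^ ((nL + 1) * n)"
    using finF by (auto simp: H_def card_PiE card_cartesian_product intro!: finite_PiE)
  have "measure_pmf.prob ?M ?E \<le> measure_pmf.prob ?M (\<Union>(z, B)\<in>Z \<times> H. X z B)"
  proof (rule measure_pmf.finite_measure_mono_AE, rule AE_pmfI, rule impI)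
    fix \<omega> assume \<omega>: "\<omega> \<in> set_pmf ?M" and "\<omega> \<in> ?E"
    then obtain z where z: "z \<in> Z" "merges nL T m (latent \<omega>) z"
      "profile_loglik n T (observed \<omega>) (latent \<omega>) \<le> profile_loglik n T (observed \<omega>) z"
      by (auto simp: Z_def)
    define B where "B = restrict (\<lambda>(i, j). A_hat T (observed \<omega>) z i j) ({0..nL} \<times> {1..n})"
    have "A_hat T (observed \<omega>) z i j \<in> F" for i j
    proof -
      have "card {t\<in>{1..T}. z t = i \<and> observed \<omega> t j} \<le> card {1..T}"
        "group_count T z i \<le> card {1..T}"
        unfolding group_count_def by (intro card_mono; auto)+
      then show ?thesis
        using A_hat_in_unit[of T "observed \<omega>" z i j] unfolding F_def A_hat_eq by force
    qed
    then have "B \<in> H"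
      by (auto simp: H_def B_def)
    moreover have BA: "B (z t, j) = A_hat T (observed \<omega>) z (z t) j"
      if "t \<in> {1..T}" "j \<in> {1..n}" for t j
      using z(1) that by (auto simp: B_def Z_def)
    have "(\<Prod>t\<in>{1..T}. \<Prod>j\<in>{1..n}. bernoulli_lik (B (z t, j)) (observed \<omega> t j))
        = (\<Prod>t\<in>{1..T}. \<Prod>j\<in>{1..n}.
            bernoulli_lik (A_hat T (observed \<omega>) z (z t) j) (observed \<omega> t j))"
      by (intro prod.cong refl) (simp only: BA)
    then have "\<omega> \<in> X z B"
      using lik_le_profile_lik[OF hub \<omega> z(3)] z(2) by (simp add: X_def)
    ultimately show "\<omega> \<in> (\<Union>(z, B)\<in>Z \<times> H. X z B)"
      using z(1) by auto
  qed simp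
  also have "\<dots> \<le> (\<Sum>zB\<in>Z \<times> H. measure_pmf.prob ?M (case zB of (z, B) \<Rightarrow> X z B))"
    using finZ finH by (intro measure_pmf.finite_measure_subadditive_finite) auto
  also have "\<dots> \<le> (\<Sum>zB\<in>Z \<times> H. exp (- (m * D) / 8))"
  proof (rule sum_mono)
    fix zB assume "zB \<in> Z \<times> H"
    then obtain z B where zB: "zB = (z, B)" "z \<in> Z" "B \<in> H" by auto
    have "B (z t, j) \<in> {0..1}" if "t \<in> {1..T}" "j \<in> {1..n}" for t j
    proof -
      have "B (z t, j) \<in> F"
        using zB(2,3) that unfolding H_def Z_def by (intro PiE_mem[of B]) auto
      then show ?thesis by (simp add: F_def)
    qed
    then show "measure_pmf.prob ?M (case zB of (z, B) \<Rightarrow> X z B) \<le> exp (- (m * D) / 8)"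
      using prob_merges_lik_le[OF hub sep D, where B = "\<lambda>i j. B (i, j)" and z = z] zB
      by (simp add: X_def)
  qed
  also have "\<dots> = real (card Z) * real (card H) * exp (- (m * D) / 8)"
    by (simp add: card_cartesian_product)
  also have "\<dots> \<le> (real nL + 1) ^ T * (real T + 1) ^ (2 * ((nL + 1) * n)) * exp (- (m * D) / 8)"
  proof (intro mult_right_mono mult_mono)
    have "card H \<le> ((T + 1)\<^sup>2) ^ ((nL + 1) * n)"
      unfolding finH by (intro power_mono cardF) auto
    also have "\<dots> = (T + 1) ^ (2 * ((nL + 1) * n))"
      by (rule power_mult[symmetric])
    finally have "real (card H) \<le> real ((T + 1) ^ (2 * ((nL + 1) * n)))"
      by (rule of_nat_mono)
    then show "real (card H) \<le> (real T + 1) ^ (2 * ((nL + 1) * n))"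
      by (simp add: add.commute)
  qed (simp_all add: finZ add.commute)
  finally show ?thesis .
qed

section \<open>From mislabeled groups to merging\<close>

lemma row_distance_ge:
  assumes J: "finite J" and V: "V \<subseteq> J" and d: "0 \<le> d" and gap: "\<And>j. j \<in> V \<Longrightarrow> d \<le> x j - y j"
  shows "real (card V) * d\<^sup>2 \<le> (\<Sum>j\<in>J. (x j - y j)\<^sup>2)"
proof -
  have "real (card V) * d\<^sup>2 = (\<Sum>j\<in>V. d\<^sup>2)" by simp
  also have "\<dots> \<le> (\<Sum>j\<in>V. (x j - y j)\<^sup>2)"
    using d gap by (intro sum_mono power_mono) auto
  also have "\<dots> \<le> (\<Sum>j\<in>J. (x j - y j)\<^sup>2)"
    by (intro sum_mono2 J V) auto
  finally show ?thesis .
qed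

text \<open>The excluded columns \<open>S\<close> cover three uses: none for row totals, the true
  label for errors, and a wrong leader for the groups it fails to absorb.\<close>

lemma sum_confusion:
  assumes "\<And>t. t \<in> {1..T} \<Longrightarrow> z t \<le> K"
  shows "(\<Sum>b\<in>{..K} - S. confusion T l z a b) = card {t\<in>{1..T}. l t = a \<and> z t \<notin> S}"
proof -
  have "card {t\<in>{1..T}. l t = a \<and> z t \<notin> S} = card (\<Union>b\<in>{..K} - S. {t\<in>{1..T}. l t = a \<and> z t = b})"
    using assms by (intro arg_cong[where f = card]) auto
  also have "\<dots> = (\<Sum>b\<in>{..K} - S. confusion T l z a b)"
    unfolding confusion_def by (intro card_UN_disjoint) auto
  finally show ?thesis by simp
qed

lemma mislabeled_le_sum_confusion:
  assumes "\<And>t. t \<in> {1..T} \<Longrightarrow> l t \<le> K" "\<And>t. t \<in> {1..T} \<Longrightarrow> z t \<le> K"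
  shows "mislabeled T l z \<le> (\<Sum>a\<le>K. \<Sum>b\<in>{..K} - {a}. confusion T l z a b)"
proof -
  have "mislabeled T l z \<le> card (\<Union>a\<in>{..K}. {t\<in>{1..T}. l t = a \<and> z t \<notin> {a}})"
    unfolding mislabeled_def using assms by (intro card_mono) auto
  also have "\<dots> \<le> (\<Sum>a\<le>K. card {t\<in>{1..T}. l t = a \<and> z t \<notin> {a}})"
    by (intro card_UN_le) simp
  also have "\<dots> = (\<Sum>a\<le>K. \<Sum>b\<in>{..K} - {a}. confusion T l z a b)"
    using sum_confusion[of T z K] assms by simp
  finally show ?thesis .
qed

text \<open>
  Feasibility is what pins down the names of the labels: a group in which leader \<open>i\<close> is absent
  cannot be labelled \<open>i\<close>, and every true label has many such groups.
\<close>

lemma feasible_mislabeled_imp_merges: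
  assumes z: "feasible nL T G z" and l: "\<And>t. t \<in> {1..T} \<Longrightarrow> l t \<le> nL"
    and size: "\<And>a. a \<le> nL \<Longrightarrow> (real nL + 1) * m < real (card {t\<in>{1..T}. l t = a})"
    and absent: "\<And>a i. a \<le> nL \<Longrightarrow> i \<in> {1..nL} \<Longrightarrow> i \<noteq> a \<Longrightarrow>
      (real nL + 1) * m < real (card {t\<in>{1..T}. l t = a \<and> \<not> G t i})"
    and m: "0 \<le> m"
    and mis: "(real nL + 1)\<^sup>2 * m < real (mislabeled T l z)"
  shows "merges nL T m l z"
proof (rule ccontr)
  assume not_merges: "\<not> merges nL T m l z"
  let ?N = "\<lambda>a b. real (confusion T l z a b)"
  have z_le: "z t \<le> nL" and z_ok: "z t = 0 \<or> G t (z t)" if "t \<in> {1..T}" for t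
    using z that by (auto simp: feasible_def)
  have row_le: "(\<Sum>b\<in>{..nL} - {c}. ?N a b) \<le> (real nL + 1) * m"
    if "\<And>b. b \<le> nL \<Longrightarrow> b \<noteq> c \<Longrightarrow> ?N a b < m" for a c
  proof -
    have "(\<Sum>b\<in>{..nL} - {c}. ?N a b) \<le> (\<Sum>b\<in>{..nL} - {c}. m)"
      using that by (intro sum_mono less_imp_le) auto
    also have "\<dots> = real (card ({..nL} - {c})) * m"
      by simp
    also have "\<dots> \<le> (real nL + 1) * m"
    proof (rule mult_right_mono[OF _ m])
      have "card ({..nL} - {c}) \<le> card {..nL}"
        by (intro card_mono) auto
      then show "real (card ({..nL} - {c})) \<le> real nL + 1" by simp
    qed
    finally show ?thesis .
  qed
  have "(real nL + 1) * m < (\<Sum>b\<le>nL. ?N a b)" if "a \<le> nL" for a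
    using size[OF that] sum_confusion[of T z nL l a "{}"] z_le by (simp flip: of_nat_sum)
  moreover have "a = a'" if "a \<le> nL" "a' \<le> nL" "m \<le> ?N a b" "m \<le> ?N a' b" for a a' b
    using not_merges that unfolding merges_def by blast
  ultimately show False
  proof (rule confusion_matrix_cases)
    assume diag: "\<And>a b. a \<le> nL \<Longrightarrow> b \<le> nL \<Longrightarrow> a \<noteq> b \<Longrightarrow> ?N a b < m"
    have "real (mislabeled T l z) \<le> real (\<Sum>a\<le>nL. \<Sum>b\<in>{..nL} - {a}. confusion T l z a b)"
      by (intro of_nat_mono mislabeled_le_sum_confusion l z_le)
    also have "\<dots> = (\<Sum>a\<le>nL. \<Sum>b\<in>{..nL} - {a}. ?N a b)"
      by simp
    also have "\<dots> \<le> (\<Sum>a\<le>nL. (real nL + 1) * m)"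
      by (intro sum_mono row_le diag) auto
    also have "\<dots> = (real nL + 1)\<^sup>2 * m"
      by (simp add: power2_eq_square algebra_simps)
    finally show False
      using mis by simp
  next
    fix a b assume ab: "a \<le> nL" "b \<le> nL" "b \<noteq> 0" "b \<noteq> a"
      and off: "\<And>b'. b' \<le> nL \<Longrightarrow> b' \<noteq> b \<Longrightarrow> ?N a b' < m"
    have "{t\<in>{1..T}. l t = a \<and> \<not> G t b} \<subseteq> {t\<in>{1..T}. l t = a \<and> z t \<notin> {b}}"
    proof
      fix t assume "t \<in> {t\<in>{1..T}. l t = a \<and> \<not> G t b}"
      then show "t \<in> {t\<in>{1..T}. l t = a \<and> z t \<notin> {b}}"
        using z_ok[of t] ab(3) by auto
    qed
    then have "card {t\<in>{1..T}. l t = a \<and> \<not> G t b} \<le> card {t\<in>{1..T}. l t = a \<and> z t \<notin> {b}}"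
      by (intro card_mono) auto
    also have "\<dots> = (\<Sum>b'\<in>{..nL} - {b}. confusion T l z a b')"
      using sum_confusion[of T z nL l a "{b}"] z_le by simp
    finally have "real (card {t\<in>{1..T}. l t = a \<and> \<not> G t b}) \<le> (\<Sum>b'\<in>{..nL} - {b}. ?N a b')"
      by (metis of_nat_mono of_nat_sum)
    also have "\<dots> \<le> (real nL + 1) * m"
      by (intro row_le off)
    finally show False
      using absent[of a b] ab by simp
  qed
qed

text \<open>With \<open>m = \<delta> T\<close>, too many errors force either a merging assignment at
  least as likely as the truth, or an atypically small count of groups with some label, possibly
  with some leader absent. The conditions on \<open>\<delta>\<close> put the required row sizes
  below the Chernoff threshold \<open>p * T / 4\<close> and the tolerated errors below
  \<open>\<epsilon> * T\<close>.\<close>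

lemma prob_mislabeled_le:
  fixes A :: "nat \<Rightarrow> nat \<Rightarrow> real"
  assumes hub: "hub_params nL n \<rho> A"
    and sep: "\<And>a a'. a \<le> nL \<Longrightarrow> a' \<le> nL \<Longrightarrow> a \<noteq> a' \<Longrightarrow> D \<le> (\<Sum>j\<in>{1..n}. (A a j - A a' j)\<^sup>2)"
    and D: "0 \<le> D"
    and p_label: "\<And>a. a \<le> nL \<Longrightarrow> p \<le> \<rho> a"
    and p_absent: "\<And>a i. a \<le> nL \<Longrightarrow> i \<in> {1..nL} \<Longrightarrow> i \<noteq> a \<Longrightarrow> p \<le> \<rho> a * (1 - A a i)"
    and \<delta>: "0 \<le> \<delta>" "(real nL + 1) * \<delta> < p / 4" "(real nL + 1)\<^sup>2 * \<delta> \<le> \<epsilon>"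
    and T: "1 \<le> T"
    and mle: "\<And>G. profile_mle nL n T G (z_hat G)"
  shows "measure_pmf.prob (hub_pmf nL n T \<rho> A)
      {\<omega>. \<bar>real (mislabeled T (latent \<omega>) (z_hat (observed \<omega>))) / real T\<bar> > \<epsilon>}
    \<le> (real nL + 1) ^ T * (real T + 1) ^ (2 * ((nL + 1) * n)) * exp (- (\<delta> * real T * D) / 8)
      + (real nL + 1)\<^sup>2 * exp (- (p * real T) / 4)"
    (is "measure_pmf.prob ?M ?E \<le> ?U + _")
proof -
  define m where "m = \<delta> * real T"
  define X where "X = {\<omega>. \<exists>z\<in>{1..T} \<rightarrow>\<^sub>E {0..nL}. merges nL T m (latent \<omega>) z \<and>
    profile_loglik n T (observed \<omega>) (latent \<omega>) \<le> profile_loglik n T (observed \<omega>) z}"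
  \<comment> \<open>One predicate serves both kinds of count: for \<open>i = 0\<close> or
    \<open>i = a\<close> only the label is tested, otherwise also the absence of leader
    \<open>i\<close>. The union then runs over all (nL+1)^2 pairs.\<close>
  define Q where "Q a i x \<longleftrightarrow> fst x = a \<and> (i \<noteq> 0 \<longrightarrow> i \<noteq> a \<longrightarrow> \<not> snd x i)"
    for a i :: nat and x :: "nat \<times> (nat \<Rightarrow> bool)"
  define Y where "Y = (\<lambda>(a, i). {\<omega> :: nat \<Rightarrow> nat \<times> (nat \<Rightarrow> bool).
    real (card {t\<in>{1..T}. Q a i (\<omega> t)}) < p * real (card {1..T}) / 4})"
  let ?L = "{0..nL} \<times> {0..nL}"
  have m_less: "(real nL + 1) * m < p * real T / 4"
    using mult_strict_right_mono[OF \<delta>(2), of "real T"] T by (simp add: m_def algebra_simps)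
  have "measure_pmf.prob ?M ?E \<le> measure_pmf.prob ?M (X \<union> \<Union> (Y ` ?L))"
  proof (rule measure_pmf.finite_measure_mono_AE, rule AE_pmfI, rule impI)
    fix \<omega> assume \<omega>: "\<omega> \<in> set_pmf ?M" and "\<omega> \<in> ?E"
    then have err: "\<epsilon> < real (mislabeled T (latent \<omega>) (z_hat (observed \<omega>))) / real T"
      by simp
    let ?z = "z_hat (observed \<omega>)"
    have feas: "feasible nL T (observed \<omega>) ?z"
      and opt: "profile_loglik n T (observed \<omega>) (latent \<omega>) \<le> profile_loglik n T (observed \<omega>) ?z"
      using mle[of "observed \<omega>"] feasible_latent[OF hub \<omega>]
      by (auto simp: profile_mle_def is_arg_max_def not_less)
    show "\<omega> \<in> X \<union> \<Union> (Y ` ?L)"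
    proof (cases "\<omega> \<in> \<Union> (Y ` ?L)")
      case False
      then have count: "p * real T / 4 \<le> real (card {t\<in>{1..T}. Q a i (\<omega> t)})"
        if "a \<le> nL" "i \<le> nL" for a i
        using that by (force simp: Y_def not_less)
      have "merges nL T m (latent \<omega>) ?z"
      proof (rule feasible_mislabeled_imp_merges[OF feas])
        show "latent \<omega> t \<le> nL" if "t \<in> {1..T}" for t
          using set_pmf_hub_pmf(1)[OF hub \<omega> that] by simp
        show "(real nL + 1) * m < real (card {t\<in>{1..T}. latent \<omega> t = a})" if "a \<le> nL" for a
          using count[OF that, of 0] m_less by (simp add: Q_def latent_def)
        show "(real nL + 1) * m < real (card {t\<in>{1..T}. latent \<omega> t = a \<and> \<not> observed \<omega> t i})"
          if "a \<le> nL" "i \<in> {1..nL}" "i \<noteq> a" for a i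
          using count[of a i] m_less that by (simp add: Q_def latent_def observed_def)
        show "0 \<le> m" using \<delta> by (simp add: m_def)
        have "(real nL + 1)\<^sup>2 * m \<le> \<epsilon> * real T"
          using mult_right_mono[OF \<delta>(3), of "real T"] by (simp add: m_def mult.assoc)
        also have "\<dots> < real (mislabeled T (latent \<omega>) ?z)"
          using err T by (simp add: pos_less_divide_eq)
        finally show "(real nL + 1)\<^sup>2 * m < real (mislabeled T (latent \<omega>) ?z)" .
      qed
      \<comment> \<open>The union bound ranges over the finite set of extensional functions, so the
        values of the estimator outside \<open>{1..T}\<close> are discarded.\<close>
      moreover define z where "z = restrict ?z {1..T}"
      ultimately have "merges nL T m (latent \<omega>) z"
        using merges_cong[of T "latent \<omega>" "latent \<omega>" z ?z] by simp
      moreover have "profile_loglik n T (observed \<omega>) z = profile_loglik n T (observed \<omega>) ?z"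
        by (rule profile_loglik_cong) (simp add: z_def)
      moreover have "z \<in> {1..T} \<rightarrow>\<^sub>E {0..nL}"
        using feas by (auto simp: z_def feasible_def)
      ultimately have "\<omega> \<in> X"
        using opt unfolding X_def by auto
      then show ?thesis by simp
    qed simp
  qed simp
  also have "\<dots> \<le> measure_pmf.prob ?M X + measure_pmf.prob ?M (\<Union> (Y ` ?L))"
    by (intro measure_Un_le) auto
  also have "measure_pmf.prob ?M X \<le> ?U"
    unfolding X_def m_def[symmetric] using sep by (intro prob_merges_profile_le[OF hub _ D])
  also have "measure_pmf.prob ?M (\<Union> (Y ` ?L)) \<le> (\<Sum>ai\<in>?L. measure_pmf.prob ?M (Y ai))"
    by (intro measure_pmf.finite_measure_subadditive_finite) auto
  also have "\<dots> \<le> (\<Sum>ai\<in>?L. exp (- (p * real T) / 4))"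
  proof (rule sum_mono)
    fix ai assume "ai \<in> ?L"
    then obtain a i where ai: "ai = (a, i)" "a \<le> nL" "i \<le> nL" by auto
    have "p \<le> measure_pmf.prob (group_pmf nL n \<rho> A) {x. Q a i x}"
    proof (cases "i \<noteq> 0 \<and> i \<noteq> a")
      case True
      then have "p \<le> \<rho> a * (1 - A a i)"
        using p_absent ai by simp
      also have "\<dots> \<le> measure_pmf.prob (group_pmf nL n \<rho> A) {x. fst x = a \<and> \<not> snd x i}"
        using hub ai True by (intro prob_group_pmf_label_absent) (auto simp: hub_params_def)
      finally show ?thesis
        using True by (simp add: Q_def)
    next
      case False
      then have "{x. Q a i x} = {x. fst x = a}"
        by (auto simp: Q_def)
      then show ?thesis
        using prob_group_pmf_label[OF hub ai(2)] p_label ai by simp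
    qed
    then show "measure_pmf.prob ?M (Y ai) \<le> exp (- (p * real T) / 4)"
      using Pi_pmf_count_lower_tail[of "{1..T}" p "group_pmf nL n \<rho> A" "Q a i" "(0, \<lambda>_. False)"]
      by (simp add: hub_pmf_def Y_def ai)
  qed
  also have "\<dots> = (real nL + 1)\<^sup>2 * exp (- (p * real T) / 4)"
    by (simp add: power2_eq_square algebra_simps)
  finally show ?thesis by simp
qed

section \<open>Asymptotics\<close>

text \<open>With y = \<delta> w T / L the exponential gain is y/8. The labels and the grid cost at
  most y/32 each, and the remaining y/16 is at least T; this fixes the constants 32 and 16. The 128
  is 32 times 4, the 4 coming from the two coordinates of a grid point and from ln(T+1) \<le> 2 ln
  T.\<close>

lemma union_bound_le_exp:
  fixes w s \<delta> :: real and K n T L :: nat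
  assumes T: "2 \<le> T" and K: "1 \<le> K" and L: "1 \<le> L" and \<delta>: "0 < \<delta>"
    and w: "w = s * real n" "0 < s"
    and w1: "32 * real L * ln (real K) / \<delta> \<le> w" and w2: "16 * real L / \<delta> \<le> w"
    and x: "ln (real T) / (s * real T) \<le> \<delta> / (128 * real K * real L)"
  shows "real K ^ T * (real T + 1) ^ (2 * (K * n)) * exp (- (\<delta> * real T * (w / real L)) / 8)
    \<le> exp (- real T)"
proof -
  have "real T + 1 \<le> real T * real T"
  proof -
    have "1 + real T \<le> 2 * real T" using T by simp
    also have "\<dots> \<le> real T * real T" using T by (intro mult_right_mono) auto
    finally show ?thesis by simp
  qed
  then have "ln (real T + 1) \<le> ln (real T * real T)"
    using T by (subst ln_le_cancel_iff) auto
  then have lnT: "ln (real T + 1) \<le> 2 * ln (real T)"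
    using T by (simp add: ln_mult)
  have lnT': "ln (real T) \<le> \<delta> / (128 * real K * real L) * (s * real T)"
    using x w(2) T by (simp add: pos_divide_le_eq)
  have K_ln: "ln (real K) \<le> \<delta> * w / (32 * real L)"
    using w1 \<delta> L by (simp add: field_simps)
  have "real (2 * (K * n)) * ln (real T + 1) \<le> real (2 * (K * n)) * (2 * ln (real T))"
    using lnT by (intro mult_left_mono) auto
  also have "\<dots> \<le> real (2 * (K * n)) * (2 * (\<delta> / (128 * real K * real L) * (s * real T)))"
    using lnT' by (intro mult_left_mono) auto
  also have "\<dots> = \<delta> * w * real T / (32 * real L)"
    using K L by (simp add: w field_simps)
  finally have 1: "real (2 * (K * n)) * ln (real T + 1) \<le> \<delta> * w * real T / (32 * real L)" .
  have 2: "real T * ln (real K) \<le> \<delta> * w * real T / (32 * real L)"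
    using mult_left_mono[OF K_ln, of "real T"] by (simp add: mult.commute)
  have "16 * real L \<le> \<delta> * w"
    using w2 \<delta> by (simp add: field_simps)
  then have "1 \<le> \<delta> * w / (16 * real L)"
    using L by (simp add: field_simps)
  then have 3: "real T \<le> \<delta> * w * real T / (16 * real L)"
    using mult_left_mono[of 1 "\<delta> * w / (16 * real L)" "real T"] by (simp add: mult.commute)
  have "real K ^ T = exp (real T * ln (real K))"
    using K by (simp add: exp_of_nat_mult)
  moreover have "(real T + 1) ^ (2 * (K * n)) = exp (real (2 * (K * n)) * ln (real T + 1))"
    by (subst exp_of_nat_mult) (simp add: add_pos_nonneg)
  ultimately have "real K ^ T * (real T + 1) ^ (2 * (K * n)) * exp (- (\<delta> * real T * (w / real L)) / 8)
      = exp (real T * ln (real K) + real (2 * (K * n)) * ln (real T + 1)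
          + - (\<delta> * real T * (w / real L)) / 8)"
    by (simp only: exp_add)
  also have "real T * ln (real K) + real (2 * (K * n)) * ln (real T + 1)
      + - (\<delta> * real T * (w / real L)) / 8 \<le> - real T"
  proof -
    define y where "y = \<delta> * w * real T / real L"
    have "\<delta> * w * real T / (32 * real L) = y / 32" "\<delta> * w * real T / (16 * real L) = y / 16"
      "\<delta> * real T * (w / real L) = y"
      by (simp_all add: y_def)
    note eq = this
    show ?thesis
      using 1 2 3 unfolding eq by linarith
  qed
  finally show ?thesis by simp
qed

theorem theorem9:
  fixes nL :: nat
    and n T :: "nat \<Rightarrow> nat"
    and \<rho> :: "nat \<Rightarrow> nat \<Rightarrow> real"
    and A :: "nat \<Rightarrow> nat \<Rightarrow> nat \<Rightarrow> real"
    and d v :: "nat \<Rightarrow> real"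
    and c_min c_max :: real
    and z_hat :: "nat \<Rightarrow> (nat \<Rightarrow> nat \<Rightarrow> bool) \<Rightarrow> nat \<Rightarrow> nat"
  assumes "1 \<le> nL"
    and "\<And>k. hub_params nL (n k) (\<rho> k) (A k)"
    and "filterlim n at_top sequentially"
    and "filterlim T at_top sequentially"
    and "0 < c_min" and "0 < c_max"
    and "\<And>k. Min (\<rho> k ` {0..nL}) = c_min / real nL"
    and "\<And>k. Max (\<rho> k ` {0..nL}) = c_max / real nL"
    and "\<And>k. 0 < d k \<and> d k \<le> 1"
    and "\<And>k. 0 < v k \<and> v k \<le> 1"
    and "\<And>k i. i \<in> {1..nL} \<Longrightarrow>
           \<exists>V\<subseteq>{1..n k}. real (card V) \<ge> v k * real (n k) / real nL \<and>
             (\<forall>j\<in>V. \<forall>i'\<in>{0..nL}. i' \<noteq> i \<longrightarrow> A k i j - A k i' j \<ge> d k)"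
    and "\<exists>c<1. \<forall>k. \<forall>i\<in>{0..nL}. \<forall>i'\<in>{1..nL}. i \<noteq> i' \<longrightarrow> A k i i' \<le> c"
    and "(\<lambda>k. ln (real (T k)) / ((d k)\<^sup>2 * v k * real (T k))) \<longlonglongrightarrow> 0"
    and "filterlim (\<lambda>k. (d k) ^ 4 * (v k)\<^sup>2 * real (n k)) at_top sequentially"
    and "\<And>k G. profile_mle nL (n k) (T k) G (z_hat k G)"
  shows "little_op_one (\<lambda>k. hub_pmf nL (n k) (T k) (\<rho> k) (A k))
           (\<lambda>k \<omega>. real (mislabeled (T k) (latent \<omega>) (z_hat k (observed \<omega>))) / real (T k))"
  unfolding little_op_one_def
proof (intro allI impI)
  fix \<epsilon> :: real assume \<epsilon>: "0 < \<epsilon>"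
  note hub = assms(2)
  obtain c where c: "c < 1"
    "\<And>k i i'. i \<in> {0..nL} \<Longrightarrow> i' \<in> {1..nL} \<Longrightarrow> i \<noteq> i' \<Longrightarrow> A k i i' \<le> c"
    using assms(12) by blast
  \<comment> \<open>Shows \<open>c\<close> to be nonnegative, so that \<open>p\<close> below does
    not exceed \<open>r\<close> and bounds the plain label probabilities as well.\<close>
  have "0 \<le> A 0 0 1"
    using hub[of 0] \<open>1 \<le> nL\<close> by (simp add: hub_params_def)
  then have c0: "0 \<le> c"
    using c(2)[of 0 1 0] \<open>1 \<le> nL\<close> by simp
  define r where "r = c_min / real nL"
  define p where "p = r * (1 - c)"
  \<comment> \<open>The 8 gives \<open>(nL + 1) * \<delta>\<close> at most p/8, hence strictly below
    the p/4 that is required.\<close>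
  define \<delta> where "\<delta> = min (p / (8 * (real nL + 1))) (\<epsilon> / (real nL + 1)\<^sup>2)"
  define s where "s k = (d k)\<^sup>2 * v k" for k
  define w where "w k = s k * real (n k)" for k
  have r: "0 < r"
    using \<open>1 \<le> nL\<close> \<open>0 < c_min\<close> by (simp add: r_def)
  have p: "0 < p"
    using r c(1) by (simp add: p_def)
  have \<rho>: "r \<le> \<rho> k a" if "a \<le> nL" for k a
    unfolding r_def assms(7)[of k, symmetric] using that by (intro Min_le) auto
  have \<delta>: "0 < \<delta>"
    using p \<epsilon> by (simp add: \<delta>_def)
  have \<delta>1: "(real nL + 1) * \<delta> < p / 4"
  proof -
    have "(real nL + 1) * \<delta> \<le> (real nL + 1) * (p / (8 * (real nL + 1)))"
      by (intro mult_left_mono) (auto simp: \<delta>_def)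
    also have "\<dots> = p / 8"
    proof -
      have "x * (p / (8 * x)) = p / 8" if "0 < x" for x
        using that by simp
      then show ?thesis by (simp only: of_nat_0_le_iff add_nonneg_pos zero_less_one)
    qed
    finally show ?thesis using p by simp
  qed
  have \<delta>2: "(real nL + 1)\<^sup>2 * \<delta> \<le> \<epsilon>"
  proof -
    have "(real nL + 1)\<^sup>2 * \<delta> \<le> (real nL + 1)\<^sup>2 * (\<epsilon> / (real nL + 1)\<^sup>2)"
      by (intro mult_left_mono) (auto simp: \<delta>_def)
    then show ?thesis
      by (simp add: add_nonneg_eq_0_iff)
  qed
  have s: "0 < s k" for k
    using assms(9,10)[of k] by (simp add: s_def)
  have sep_leader: "w k / real nL \<le> (\<Sum>j\<in>{1..n k}. (A k a j - A k a' j)\<^sup>2)"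
    if a: "a \<in> {1..nL}" "a' \<le> nL" "a \<noteq> a'" for k a a'
  proof -
    have a': "a' \<in> {0..nL}" "a' \<noteq> a"
      using a by auto
    obtain V where V: "V \<subseteq> {1..n k}" "v k * real (n k) / real nL \<le> real (card V)"
      "\<forall>j\<in>V. \<forall>i'\<in>{0..nL}. i' \<noteq> a \<longrightarrow> d k \<le> A k a j - A k i' j"
      using assms(11)[OF a(1), of k] by (elim exE conjE) (rule that)
    have gap: "d k \<le> A k a j - A k a' j" if "j \<in> V" for j
      using V(3) a' that by blast
    have "w k / real nL = v k * real (n k) / real nL * (d k)\<^sup>2"
      by (simp add: w_def s_def)
    also have "\<dots> \<le> real (card V) * (d k)\<^sup>2"
      using V(2) by (rule mult_right_mono) simp
    also have "\<dots> \<le> (\<Sum>j\<in>{1..n k}. (A k a j - A k a' j)\<^sup>2)"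
      using assms(9)[of k] by (intro row_distance_ge finite_atLeastAtMost V(1) gap) simp
    finally show ?thesis .
  qed
  \<comment> \<open>The separating sets are given for leaders only, but of two distinct labels at
    least one is a leader, and the squared distance is symmetric.\<close>
  have sep: "w k / real nL \<le> (\<Sum>j\<in>{1..n k}. (A k a j - A k a' j)\<^sup>2)"
    if "a \<le> nL" "a' \<le> nL" "a \<noteq> a'" for k a a'
  proof (cases "a = 0")
    case True
    then show ?thesis
      using sep_leader[of a' a k] that by (simp add: power2_commute)
  qed (use sep_leader[of a a' k] that in simp)
  \<comment> \<open>As d^2 v \<le> 1, its square d^4 v^2 is at most d^2 v, so \<open>w\<close>
    dominates a sequence tending to infinity.\<close>
  have w_lim: "filterlim w at_top sequentially"
  proof (rule filterlim_at_top_mono[OF assms(14)], rule always_eventually, rule allI)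
    fix k
    have "(s k)\<^sup>2 \<le> s k"
    proof -
      have "s k \<le> 1"
        using assms(9,10)[of k] unfolding s_def by (intro mult_le_one) (auto simp: power_le_one)
      then show ?thesis
        using s[of k] by (simp add: power2_eq_square mult_left_le)
    qed
    moreover have "(s k)\<^sup>2 = d k ^ 4 * (v k)\<^sup>2"
      by (simp add: s_def power_mult_distrib flip: power_mult)
    ultimately show "d k ^ 4 * (v k)\<^sup>2 * real (n k) \<le> w k"
      unfolding w_def by (simp add: mult_right_mono)
  qed
  have T_lim: "filterlim (\<lambda>k. real (T k)) at_top sequentially"
    by (rule filterlim_compose[OF filterlim_real_sequentially assms(4)])
  let ?P = "\<lambda>k. measure_pmf.prob (hub_pmf nL (n k) (T k) (\<rho> k) (A k))
      {\<omega>. \<bar>real (mislabeled (T k) (latent \<omega>) (z_hat k (observed \<omega>))) / real (T k)\<bar> > \<epsilon>}"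
  let ?B = "\<lambda>k. exp (- real (T k)) + (real nL + 1)\<^sup>2 * exp (- (p * real (T k)) / 4)"
  have le: "\<forall>\<^sub>F k in sequentially. ?P k \<le> ?B k"
  proof -
    have "\<forall>\<^sub>F k in sequentially. 2 \<le> T k"
      using assms(4) by (simp add: filterlim_at_top)
    moreover have "\<forall>\<^sub>F k in sequentially. 32 * real nL * ln (real (nL + 1)) / \<delta> \<le> w k"
      "\<forall>\<^sub>F k in sequentially. 16 * real nL / \<delta> \<le> w k"
      using w_lim by (simp_all add: filterlim_at_top)
    moreover have "\<forall>\<^sub>F k in sequentially.
        ln (real (T k)) / ((d k)\<^sup>2 * v k * real (T k)) < \<delta> / (128 * real (nL + 1) * real nL)"
      using \<delta> \<open>1 \<le> nL\<close> by (intro order_tendstoD(2)[OF assms(13)]) simp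
    ultimately show ?thesis
    proof eventually_elim
      case (elim k)
      have "?P k \<le> (real nL + 1) ^ T k * (real (T k) + 1) ^ (2 * ((nL + 1) * n k))
            * exp (- (\<delta> * real (T k) * (w k / real nL)) / 8)
          + (real nL + 1)\<^sup>2 * exp (- (p * real (T k)) / 4)"
      proof (rule prob_mislabeled_le[OF hub])
        show "0 \<le> w k / real nL"
          using s[of k] by (simp add: w_def)
        show "p \<le> \<rho> k a" if "a \<le> nL" for a
          using \<rho>[OF that, of k] r c0 unfolding p_def
          by (intro order_trans[OF mult_left_le]) auto
        show "p \<le> \<rho> k a * (1 - A k a i)" if "a \<le> nL" "i \<in> {1..nL}" "i \<noteq> a" for a i
          using \<rho>[OF that(1), of k] r c(1) c(2)[of a i k] that unfolding p_def
          by (intro mult_mono) auto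
        show "0 \<le> \<delta>" "1 \<le> T k"
          using \<delta> elim by auto
      qed (rule sep \<delta>1 \<delta>2 assms(15); assumption)+
      also have "(real nL + 1) ^ T k * (real (T k) + 1) ^ (2 * ((nL + 1) * n k))
            * exp (- (\<delta> * real (T k) * (w k / real nL)) / 8) \<le> exp (- real (T k))"
      proof -
        have "real (nL + 1) ^ T k * (real (T k) + 1) ^ (2 * ((nL + 1) * n k))
            * exp (- (\<delta> * real (T k) * (w k / real nL)) / 8) \<le> exp (- real (T k))"
          using elim \<delta> \<open>1 \<le> nL\<close> s[of k]
          by (intro union_bound_le_exp[where s = "s k"]) (auto simp: w_def s_def)
        also have "real (nL + 1) = real nL + 1"
          by simp
        finally show ?thesis .
      qed
      finally show ?case by simp
    qed
  qed
  have B_lim: "?B \<longlonglongrightarrow> 0"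
  proof -
    have exp_lim: "(\<lambda>k. exp (- (b * real (T k)))) \<longlonglongrightarrow> 0" if "0 < b" for b
      using filterlim_tendsto_pos_mult_at_top[OF tendsto_const that T_lim]
      by (intro filterlim_compose[OF exp_at_bot]) (simp add: filterlim_uminus_at_top)
    show ?thesis
      using tendsto_add[OF exp_lim[of 1] tendsto_mult_right_zero[OF exp_lim[of "p / 4"]]] p by simp
  qed
  show "?P \<longlonglongrightarrow> 0"
    by (rule tendsto_sandwich[OF _ le tendsto_const B_lim]) simp
qed

end
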